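(* Let $A_q(G)$ be a Hopf algebra over a field of characteristic zero with coproduct $\Delta_G$, and let $(A_q(K),\pi)$ be a (left or right) coisotropic quantum subgroup of $A_q(G)$. Let $\rho_L:V\to A_q(K)\otimes V$ be a left corepresentation and $\rho_R:V\to V\otimes A_q(K)$ a right corepresentation of the coalgebra $A_q(K)$ on a vector space $V$. Then $\Delta_G\otimes \mathrm{id}$ defines a left corepresentation of $A_q(G)$ on $\mathrm{ind}_K^G(\rho_L)$, and $\mathrm{id}\otimes\Delta_G$ defines a right corepresentation of $A_q(G)$ on $\mathrm{ind}_K^G(\rho_R)$.
   Context: All vector spaces are over a fixed field of characteristic zero. For a Hopf algebra $A$, a left (resp. right) coisotropic quantum subgroup of $A$ is a pair $(C,\pi)$ where $C$ is a coalgebra and a left (resp. right) $A$-module and $\pi:A\to C$ is a surjective linear map which is a coalgebra homomorphism and a left (resp. right) $A$-module homomorphism. For a coalgebra $C$ with coproduct $\Delta$ and counit $\varepsilon$, a right corepresentation on $V$ is a linear map $\psi_R:V\to V\otimes C$ with $(\mathrm{id}\otimes\varepsilon)\psi_R=\mathrm{id}_V$ and $(\mathrm{id}\otimes\Delta)\psi_R=(\psi_R\otimes\mathrm{id})\psi_R$; a left corepresentation is a linear map $\psi_L:V\to C\otimes V$ with $(\varepsilon\otimes\mathrm{id})\psi_L=\mathrm{id}_V$ and $(\Delta\otimes\mathrm{id})\psi_L=(\mathrm{id}\otimes\psi_L)\psi_L$. Put $R=(\mathrm{id}\otimes\pi)\circ\Delta_G:A_q(G)\to A_q(G)\otimes A_q(K)$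 and $L=(\pi\otimes\mathrm{id})\circ\Delta_G:A_q(G)\to A_q(K)\otimes A_q(G)$. Define $$\mathrm{ind}_K^G(\rho_L)=\{F\in A_q(G)\otimes V : (R\otimes\mathrm{id})(F)=(\mathrm{id}\otimes\rho_L)(F)\},$$ $$\mathrm{ind}_K^G(\rho_R)=\{F\in V\otimes A_q(G) : (\mathrm{id}\otimes L)(F)=(\rho_R\otimes\mathrm{id})(F)\}.$$ *)

theory Defs
  imports
    "HOL-Algebra.Generated_Groups"
    "HOL-Algebra.Free_Abelian_Groups"
    "Jordan_Normal_Form.Missing_VectorSpace"
begin

text \<open>
  A vector space is a \<open>('k, 'v) module\<close> record with \<open>vectorspace K V\<close>; its multiplicative fields
  are ignored unless it is an algebra. Linear maps are total functions of which only the values on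
  the carrier matter.
\<close>

section \<open>Tensor products over a field\<close>

text \<open>
  The tensor product is the free abelian group on \<open>V \<times> W\<close> modulo the subgroup generated by the
  relations expressing biadditivity and balancedness.
\<close>

definition tensor_relators ::
  "('k, 'm) ring_scheme \<Rightarrow> ('k, 'v, 'p) module_scheme \<Rightarrow> ('k, 'w, 'q) module_scheme
    \<Rightarrow> ('v \<times> 'w \<Rightarrow>\<^sub>0 int) set" where
  "tensor_relators K V W =
     {frag_of (v \<oplus>\<^bsub>V\<^esub> v', w) - frag_of (v, w) - frag_of (v', w) | v v' w.
        v \<in> carrier V \<and> v' \<in> carrier V \<and> w \<in> carrier W} \<union>
     {frag_of (v, w \<oplus>\<^bsub>W\<^esub> w') - frag_of (v, w) - frag_of (v, w') | v w w'.
        v \<in> carrier V \<and> w \<in> carrier W \<and> w' \<in> carrier W} \<union>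
     {frag_of (c \<odot>\<^bsub>V\<^esub> v, w) - frag_of (v, c \<odot>\<^bsub>W\<^esub> w) | c v w.
        c \<in> carrier K \<and> v \<in> carrier V \<and> w \<in> carrier W}"

definition tensor_null ::
  "('k, 'm) ring_scheme \<Rightarrow> ('k, 'v, 'p) module_scheme \<Rightarrow> ('k, 'w, 'q) module_scheme
    \<Rightarrow> ('v \<times> 'w \<Rightarrow>\<^sub>0 int) set" where
  "tensor_null K V W =
     generate (free_Abelian_group (carrier V \<times> carrier W)) (tensor_relators K V W)"

definition tensor_group ::
  "('k, 'm) ring_scheme \<Rightarrow> ('k, 'v, 'p) module_scheme \<Rightarrow> ('k, 'w, 'q) module_scheme
    \<Rightarrow> ('v \<times> 'w \<Rightarrow>\<^sub>0 int) set monoid" where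
  "tensor_group K V W = free_Abelian_group (carrier V \<times> carrier W) Mod tensor_null K V W"

definition pure_tensor ::
  "('k, 'm) ring_scheme \<Rightarrow> ('k, 'v, 'p) module_scheme \<Rightarrow> ('k, 'w, 'q) module_scheme
    \<Rightarrow> 'v \<Rightarrow> 'w \<Rightarrow> ('v \<times> 'w \<Rightarrow>\<^sub>0 int) set" where
  "pure_tensor K V W v w =
     tensor_null K V W #>\<^bsub>free_Abelian_group (carrier V \<times> carrier W)\<^esub> frag_of (v, w)"

text \<open>
  The homomorphism into \<open>G\<close> induced by the universal property from a balanced biadditive map
  \<open>\<beta>\<close>; meaningless for other \<open>\<beta>\<close>. If \<open>\<beta>\<close> is bilinear into a vector space \<open>N\<close>, this with
  \<open>G = add_monoid N\<close> is the induced linear map.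
\<close>

definition tensor_lift ::
  "('k, 'm) ring_scheme \<Rightarrow> ('k, 'v, 'p) module_scheme \<Rightarrow> ('k, 'w, 'q) module_scheme
    \<Rightarrow> ('g, 'r) monoid_scheme \<Rightarrow> ('v \<Rightarrow> 'w \<Rightarrow> 'g) \<Rightarrow> ('v \<times> 'w \<Rightarrow>\<^sub>0 int) set \<Rightarrow> 'g" where
  "tensor_lift K V W G \<beta> =
     (THE h. h \<in> extensional (carrier (tensor_group K V W)) \<and>
             h \<in> hom (tensor_group K V W) G \<and>
             (\<forall>v\<in>carrier V. \<forall>w\<in>carrier W. h (pure_tensor K V W v w) = \<beta> v w))"

definition tensor ::
  "('k, 'm) ring_scheme \<Rightarrow> ('k, 'v, 'p) module_scheme \<Rightarrow> ('k, 'w, 'q) module_scheme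
    \<Rightarrow> ('k, ('v \<times> 'w \<Rightarrow>\<^sub>0 int) set) module" where
  "tensor K V W =
     \<lparr>carrier = carrier (tensor_group K V W),
      mult = undefined, one = undefined,
      zero = \<one>\<^bsub>tensor_group K V W\<^esub>,
      add = (\<lambda>x y. x \<otimes>\<^bsub>tensor_group K V W\<^esub> y),
      smult = (\<lambda>c. tensor_lift K V W (tensor_group K V W)
                     (\<lambda>v w. pure_tensor K V W (c \<odot>\<^bsub>V\<^esub> v) w))\<rparr>"

text \<open>\<open>f \<otimes> g : V \<otimes> W \<rightarrow> V' \<otimes> W'\<close>\<close>

definition tensor_map ::
  "('k, 'm) ring_scheme \<Rightarrow> ('k, 'v, 'p) module_scheme \<Rightarrow> ('k, 'w, 'q) module_scheme
    \<Rightarrow> ('k, 'v1, 'p1) module_scheme \<Rightarrow> ('k, 'w1, 'q1) module_scheme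
    \<Rightarrow> ('v \<Rightarrow> 'v1) \<Rightarrow> ('w \<Rightarrow> 'w1)
    \<Rightarrow> ('v \<times> 'w \<Rightarrow>\<^sub>0 int) set \<Rightarrow> ('v1 \<times> 'w1 \<Rightarrow>\<^sub>0 int) set" where
  "tensor_map K V W V' W' f g =
     tensor_lift K V W (add_monoid (tensor K V' W')) (\<lambda>v w. pure_tensor K V' W' (f v) (g w))"

text \<open>The canonical isomorphism \<open>(U \<otimes> V) \<otimes> W \<rightarrow> U \<otimes> (V \<otimes> W)\<close>\<close>

definition tensor_assoc ::
  "('k, 'm) ring_scheme \<Rightarrow> ('k, 'u, 'o) module_scheme \<Rightarrow> ('k, 'v, 'p) module_scheme
    \<Rightarrow> ('k, 'w, 'q) module_scheme
    \<Rightarrow> (('u \<times> 'v \<Rightarrow>\<^sub>0 int) set \<times> 'w \<Rightarrow>\<^sub>0 int) set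
    \<Rightarrow> ('u \<times> ('v \<times> 'w \<Rightarrow>\<^sub>0 int) set \<Rightarrow>\<^sub>0 int) set" where
  "tensor_assoc K U V W =
     tensor_lift K (tensor K U V) W (add_monoid (tensor K U (tensor K V W)))
       (\<lambda>t w. tensor_lift K U V (add_monoid (tensor K U (tensor K V W)))
          (\<lambda>u v. pure_tensor K U (tensor K V W) u (pure_tensor K V W v w)) t)"

section \<open>Coalgebras and corepresentations\<close>

definition base_space :: "('k, 'm) ring_scheme \<Rightarrow> ('k, 'k) module" where
  "base_space K =
     \<lparr>carrier = carrier K, mult = mult K, one = \<one>\<^bsub>K\<^esub>, zero = \<zero>\<^bsub>K\<^esub>, add = add K, smult = mult K\<rparr>"

text \<open>
  The maps \<open>\<epsilon> \<otimes> id\<close> and \<open>id \<otimes> \<epsilon>\<close> below are composed with the identifications \<open>K \<otimes> V = V\<close> and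
  \<open>V \<otimes> K = V\<close>.
\<close>

definition counit_left ::
  "('k, 'm) ring_scheme \<Rightarrow> ('k, 'c, 'p) module_scheme \<Rightarrow> ('k, 'v, 'q) module_scheme
    \<Rightarrow> ('c \<Rightarrow> 'k) \<Rightarrow> ('c \<times> 'v \<Rightarrow>\<^sub>0 int) set \<Rightarrow> 'v" where
  "counit_left K C V \<epsilon> = tensor_lift K C V (add_monoid V) (\<lambda>c v. \<epsilon> c \<odot>\<^bsub>V\<^esub> v)"

definition counit_right ::
  "('k, 'm) ring_scheme \<Rightarrow> ('k, 'v, 'q) module_scheme \<Rightarrow> ('k, 'c, 'p) module_scheme
    \<Rightarrow> ('c \<Rightarrow> 'k) \<Rightarrow> ('v \<times> 'c \<Rightarrow>\<^sub>0 int) set \<Rightarrow> 'v" where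
  "counit_right K V C \<epsilon> = tensor_lift K V C (add_monoid V) (\<lambda>v c. \<epsilon> c \<odot>\<^bsub>V\<^esub> v)"

definition coalgebra ::
  "('k, 'm) ring_scheme \<Rightarrow> ('k, 'c, 'p) module_scheme
    \<Rightarrow> ('c \<Rightarrow> ('c \<times> 'c \<Rightarrow>\<^sub>0 int) set) \<Rightarrow> ('c \<Rightarrow> 'k) \<Rightarrow> bool" where
  "coalgebra K C \<Delta> \<epsilon> \<longleftrightarrow>
     linear_map K C (tensor K C C) \<Delta> \<and>
     linear_map K C (base_space K) \<epsilon> \<and>
     (\<forall>c\<in>carrier C.
        tensor_assoc K C C C (tensor_map K C C (tensor K C C) C \<Delta> id (\<Delta> c))
          = tensor_map K C C C (tensor K C C) id \<Delta> (\<Delta> c)) \<and>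
     (\<forall>c\<in>carrier C. counit_left K C C \<epsilon> (\<Delta> c) = c) \<and>
     (\<forall>c\<in>carrier C. counit_right K C C \<epsilon> (\<Delta> c) = c)"

definition left_corep ::
  "('k, 'm) ring_scheme \<Rightarrow> ('k, 'c, 'p) module_scheme
    \<Rightarrow> ('c \<Rightarrow> ('c \<times> 'c \<Rightarrow>\<^sub>0 int) set) \<Rightarrow> ('c \<Rightarrow> 'k)
    \<Rightarrow> ('k, 'v, 'q) module_scheme \<Rightarrow> ('v \<Rightarrow> ('c \<times> 'v \<Rightarrow>\<^sub>0 int) set) \<Rightarrow> bool" where
  "left_corep K C \<Delta> \<epsilon> V \<psi> \<longleftrightarrow>
     linear_map K V (tensor K C V) \<psi> \<and>
     (\<forall>v\<in>carrier V. counit_left K C V \<epsilon> (\<psi> v) = v) \<and>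
     (\<forall>v\<in>carrier V.
        tensor_assoc K C C V (tensor_map K C V (tensor K C C) V \<Delta> id (\<psi> v))
          = tensor_map K C V C (tensor K C V) id \<psi> (\<psi> v))"

definition right_corep ::
  "('k, 'm) ring_scheme \<Rightarrow> ('k, 'c, 'p) module_scheme
    \<Rightarrow> ('c \<Rightarrow> ('c \<times> 'c \<Rightarrow>\<^sub>0 int) set) \<Rightarrow> ('c \<Rightarrow> 'k)
    \<Rightarrow> ('k, 'v, 'q) module_scheme \<Rightarrow> ('v \<Rightarrow> ('v \<times> 'c \<Rightarrow>\<^sub>0 int) set) \<Rightarrow> bool" where
  "right_corep K C \<Delta> \<epsilon> V \<psi> \<longleftrightarrow>
     linear_map K V (tensor K V C) \<psi> \<and>
     (\<forall>v\<in>carrier V. counit_right K V C \<epsilon> (\<psi> v) = v) \<and>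
     (\<forall>v\<in>carrier V.
        tensor_map K V C V (tensor K C C) id \<Delta> (\<psi> v)
          = tensor_assoc K V C C (tensor_map K V C (tensor K V C) C \<psi> id (\<psi> v)))"

section \<open>Hopf algebras\<close>

definition bilinear_map ::
  "('k, 'm) ring_scheme \<Rightarrow> ('k, 'u, 'o) module_scheme \<Rightarrow> ('k, 'v, 'p) module_scheme
    \<Rightarrow> ('k, 'w, 'q) module_scheme \<Rightarrow> ('u \<Rightarrow> 'v \<Rightarrow> 'w) \<Rightarrow> bool" where
  "bilinear_map K U V W \<beta> \<longleftrightarrow>
     (\<forall>u\<in>carrier U. linear_map K V W (\<beta> u)) \<and>
     (\<forall>v\<in>carrier V. linear_map K U W (\<lambda>u. \<beta> u v))"

text \<open>
  Associative unital algebras; the library's \<^const>\<open>algebra\<close> requires commutativity.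
\<close>

definition assoc_algebra :: "('k, 'm) ring_scheme \<Rightarrow> ('k, 'a, 'p) module_scheme \<Rightarrow> bool" where
  "assoc_algebra K A \<longleftrightarrow> vectorspace K A \<and> ring A \<and> bilinear_map K A A A (mult A)"

text \<open>\<open>A \<otimes> B\<close> with \<open>(a \<otimes> b) (a' \<otimes> b') = a a' \<otimes> b b'\<close>\<close>

definition tensor_algebra ::
  "('k, 'm) ring_scheme \<Rightarrow> ('k, 'a, 'p) module_scheme \<Rightarrow> ('k, 'b, 'q) module_scheme
    \<Rightarrow> ('k, ('a \<times> 'b \<Rightarrow>\<^sub>0 int) set) module" where
  "tensor_algebra K A B =
     (tensor K A B)
       \<lparr>mult := (\<lambda>x y. tensor_lift K A B (add_monoid (tensor K A B))
                  (\<lambda>a b. tensor_lift K A B (add_monoid (tensor K A B))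
                    (\<lambda>a' b'. pure_tensor K A B (a \<otimes>\<^bsub>A\<^esub> a') (b \<otimes>\<^bsub>B\<^esub> b')) y) x),
        one := pure_tensor K A B \<one>\<^bsub>A\<^esub> \<one>\<^bsub>B\<^esub>\<rparr>"

definition hopf_algebra ::
  "('k, 'm) ring_scheme \<Rightarrow> ('k, 'a, 'p) module_scheme
    \<Rightarrow> ('a \<Rightarrow> ('a \<times> 'a \<Rightarrow>\<^sub>0 int) set) \<Rightarrow> ('a \<Rightarrow> 'k) \<Rightarrow> ('a \<Rightarrow> 'a) \<Rightarrow> bool" where
  "hopf_algebra K A \<Delta> \<epsilon> S \<longleftrightarrow>
     assoc_algebra K A \<and> coalgebra K A \<Delta> \<epsilon> \<and>
     \<Delta> \<in> ring_hom A (tensor_algebra K A A) \<and> \<epsilon> \<in> ring_hom A K \<and>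
     linear_map K A A S \<and>
     (\<forall>a\<in>carrier A.
        tensor_lift K A A (add_monoid A) (mult A) (tensor_map K A A A A S id (\<Delta> a))
          = \<epsilon> a \<odot>\<^bsub>A\<^esub> \<one>\<^bsub>A\<^esub> \<and>
        tensor_lift K A A (add_monoid A) (mult A) (tensor_map K A A A A id S (\<Delta> a))
          = \<epsilon> a \<odot>\<^bsub>A\<^esub> \<one>\<^bsub>A\<^esub>)"

section \<open>Coisotropic quantum subgroups\<close>

definition left_algebra_module ::
  "('k, 'm) ring_scheme \<Rightarrow> ('k, 'a, 'p) module_scheme \<Rightarrow> ('k, 'c, 'q) module_scheme
    \<Rightarrow> ('a \<Rightarrow> 'c \<Rightarrow> 'c) \<Rightarrow> bool" where
  "left_algebra_module K A C act \<longleftrightarrow>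
     bilinear_map K A C C act \<and>
     (\<forall>x\<in>carrier C. act \<one>\<^bsub>A\<^esub> x = x) \<and>
     (\<forall>a\<in>carrier A. \<forall>b\<in>carrier A. \<forall>x\<in>carrier C. act (a \<otimes>\<^bsub>A\<^esub> b) x = act a (act b x))"

definition right_algebra_module ::
  "('k, 'm) ring_scheme \<Rightarrow> ('k, 'a, 'p) module_scheme \<Rightarrow> ('k, 'c, 'q) module_scheme
    \<Rightarrow> ('c \<Rightarrow> 'a \<Rightarrow> 'c) \<Rightarrow> bool" where
  "right_algebra_module K A C act \<longleftrightarrow>
     bilinear_map K C A C act \<and>
     (\<forall>x\<in>carrier C. act x \<one>\<^bsub>A\<^esub> = x) \<and>
     (\<forall>a\<in>carrier A. \<forall>b\<in>carrier A. \<forall>x\<in>carrier C. act x (a \<otimes>\<^bsub>A\<^esub> b) = act (act x a) b)"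

definition coalgebra_hom ::
  "('k, 'm) ring_scheme
    \<Rightarrow> ('k, 'a, 'p) module_scheme \<Rightarrow> ('a \<Rightarrow> ('a \<times> 'a \<Rightarrow>\<^sub>0 int) set) \<Rightarrow> ('a \<Rightarrow> 'k)
    \<Rightarrow> ('k, 'c, 'q) module_scheme \<Rightarrow> ('c \<Rightarrow> ('c \<times> 'c \<Rightarrow>\<^sub>0 int) set) \<Rightarrow> ('c \<Rightarrow> 'k)
    \<Rightarrow> ('a \<Rightarrow> 'c) \<Rightarrow> bool" where
  "coalgebra_hom K A \<Delta> \<epsilon> C \<Delta>' \<epsilon>' \<pi> \<longleftrightarrow>
     linear_map K A C \<pi> \<and>
     (\<forall>a\<in>carrier A. \<Delta>' (\<pi> a) = tensor_map K A A C C \<pi> \<pi> (\<Delta> a)) \<and>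
     (\<forall>a\<in>carrier A. \<epsilon>' (\<pi> a) = \<epsilon> a)"

definition left_coisotropic ::
  "('k, 'm) ring_scheme
    \<Rightarrow> ('k, 'a, 'p) module_scheme \<Rightarrow> ('a \<Rightarrow> ('a \<times> 'a \<Rightarrow>\<^sub>0 int) set) \<Rightarrow> ('a \<Rightarrow> 'k)
    \<Rightarrow> ('k, 'c, 'q) module_scheme \<Rightarrow> ('c \<Rightarrow> ('c \<times> 'c \<Rightarrow>\<^sub>0 int) set) \<Rightarrow> ('c \<Rightarrow> 'k)
    \<Rightarrow> ('a \<Rightarrow> 'c \<Rightarrow> 'c) \<Rightarrow> ('a \<Rightarrow> 'c) \<Rightarrow> bool" where
  "left_coisotropic K A \<Delta> \<epsilon> C \<Delta>' \<epsilon>' act \<pi> \<longleftrightarrow>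
     coalgebra K C \<Delta>' \<epsilon>' \<and> left_algebra_module K A C act \<and>
     \<pi> ` carrier A = carrier C \<and> coalgebra_hom K A \<Delta> \<epsilon> C \<Delta>' \<epsilon>' \<pi> \<and>
     (\<forall>a\<in>carrier A. \<forall>b\<in>carrier A. \<pi> (a \<otimes>\<^bsub>A\<^esub> b) = act a (\<pi> b))"

definition right_coisotropic ::
  "('k, 'm) ring_scheme
    \<Rightarrow> ('k, 'a, 'p) module_scheme \<Rightarrow> ('a \<Rightarrow> ('a \<times> 'a \<Rightarrow>\<^sub>0 int) set) \<Rightarrow> ('a \<Rightarrow> 'k)
    \<Rightarrow> ('k, 'c, 'q) module_scheme \<Rightarrow> ('c \<Rightarrow> ('c \<times> 'c \<Rightarrow>\<^sub>0 int) set) \<Rightarrow> ('c \<Rightarrow> 'k)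
    \<Rightarrow> ('c \<Rightarrow> 'a \<Rightarrow> 'c) \<Rightarrow> ('a \<Rightarrow> 'c) \<Rightarrow> bool" where
  "right_coisotropic K A \<Delta> \<epsilon> C \<Delta>' \<epsilon>' act \<pi> \<longleftrightarrow>
     coalgebra K C \<Delta>' \<epsilon>' \<and> right_algebra_module K A C act \<and>
     \<pi> ` carrier A = carrier C \<and> coalgebra_hom K A \<Delta> \<epsilon> C \<Delta>' \<epsilon>' \<pi> \<and>
     (\<forall>a\<in>carrier A. \<forall>b\<in>carrier A. \<pi> (a \<otimes>\<^bsub>A\<^esub> b) = act (\<pi> a) b)"

section \<open>Induced corepresentation spaces\<close>

text \<open>\<open>R = (id \<otimes> \<pi>) \<Delta>\<close> and \<open>L = (\<pi> \<otimes> id) \<Delta>\<close>\<close>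

definition coact_R ::
  "('k, 'm) ring_scheme \<Rightarrow> ('k, 'a, 'p) module_scheme \<Rightarrow> ('a \<Rightarrow> ('a \<times> 'a \<Rightarrow>\<^sub>0 int) set)
    \<Rightarrow> ('k, 'c, 'q) module_scheme \<Rightarrow> ('a \<Rightarrow> 'c) \<Rightarrow> 'a \<Rightarrow> ('a \<times> 'c \<Rightarrow>\<^sub>0 int) set" where
  "coact_R K A \<Delta> C \<pi> a = tensor_map K A A A C id \<pi> (\<Delta> a)"

definition coact_L ::
  "('k, 'm) ring_scheme \<Rightarrow> ('k, 'a, 'p) module_scheme \<Rightarrow> ('a \<Rightarrow> ('a \<times> 'a \<Rightarrow>\<^sub>0 int) set)
    \<Rightarrow> ('k, 'c, 'q) module_scheme \<Rightarrow> ('a \<Rightarrow> 'c) \<Rightarrow> 'a \<Rightarrow> ('c \<times> 'a \<Rightarrow>\<^sub>0 int) set" where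
  "coact_L K A \<Delta> C \<pi> a = tensor_map K A A C A \<pi> id (\<Delta> a)"

text \<open>The induced spaces carry the vector space structure of the ambient tensor product.\<close>

definition ind_left ::
  "('k, 'm) ring_scheme \<Rightarrow> ('k, 'a, 'p) module_scheme \<Rightarrow> ('a \<Rightarrow> ('a \<times> 'a \<Rightarrow>\<^sub>0 int) set)
    \<Rightarrow> ('k, 'c, 'q) module_scheme \<Rightarrow> ('a \<Rightarrow> 'c)
    \<Rightarrow> ('k, 'v, 'r) module_scheme \<Rightarrow> ('v \<Rightarrow> ('c \<times> 'v \<Rightarrow>\<^sub>0 int) set)
    \<Rightarrow> ('k, ('a \<times> 'v \<Rightarrow>\<^sub>0 int) set) module" where
  "ind_left K A \<Delta> C \<pi> V \<rho> =
     (tensor K A V)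
       \<lparr>carrier := {F \<in> carrier (tensor K A V).
          tensor_assoc K A C V (tensor_map K A V (tensor K A C) V (coact_R K A \<Delta> C \<pi>) id F)
            = tensor_map K A V A (tensor K C V) id \<rho> F}\<rparr>"

definition ind_right ::
  "('k, 'm) ring_scheme \<Rightarrow> ('k, 'a, 'p) module_scheme \<Rightarrow> ('a \<Rightarrow> ('a \<times> 'a \<Rightarrow>\<^sub>0 int) set)
    \<Rightarrow> ('k, 'c, 'q) module_scheme \<Rightarrow> ('a \<Rightarrow> 'c)
    \<Rightarrow> ('k, 'v, 'r) module_scheme \<Rightarrow> ('v \<Rightarrow> ('v \<times> 'c \<Rightarrow>\<^sub>0 int) set)
    \<Rightarrow> ('k, ('v \<times> 'a \<Rightarrow>\<^sub>0 int) set) module" where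
  "ind_right K A \<Delta> C \<pi> V \<rho> =
     (tensor K V A)
       \<lparr>carrier := {F \<in> carrier (tensor K V A).
          tensor_map K V A V (tensor K C A) id (coact_L K A \<Delta> C \<pi>) F
            = tensor_assoc K V C A (tensor_map K V A (tensor K V C) A \<rho> id F)}\<rparr>"

text \<open>
  \<open>\<Delta> \<otimes> id\<close> on \<open>A \<otimes> V\<close> defines a left corepresentation on the subspace \<open>I\<close> of \<open>A \<otimes> V\<close> if there
  is a left corepresentation \<open>\<psi> : I \<rightarrow> A \<otimes> I\<close> which, followed by the map
  \<open>A \<otimes> I \<rightarrow> A \<otimes> (A \<otimes> V)\<close> induced by the inclusion of \<open>I\<close> (the \<open>tensor_map\<close> of two identities), is
  \<open>\<Delta> \<otimes> id\<close> on \<open>I\<close>, and if \<open>\<psi>\<close> is uniquely determined on \<open>I\<close>. Symmetrically for \<open>id \<otimes> \<Delta>\<close>.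
\<close>

definition defines_left_corep ::
  "('k, 'm) ring_scheme \<Rightarrow> ('k, 'a, 'p) module_scheme
    \<Rightarrow> ('a \<Rightarrow> ('a \<times> 'a \<Rightarrow>\<^sub>0 int) set) \<Rightarrow> ('a \<Rightarrow> 'k) \<Rightarrow> ('k, 'v, 'r) module_scheme
    \<Rightarrow> ('k, ('a \<times> 'v \<Rightarrow>\<^sub>0 int) set, 's) module_scheme \<Rightarrow> bool" where
  "defines_left_corep K A \<Delta> \<epsilon> V I \<longleftrightarrow>
     (\<exists>!\<psi>. \<psi> \<in> extensional (carrier I) \<and> left_corep K A \<Delta> \<epsilon> I \<psi> \<and>
        (\<forall>F\<in>carrier I.
           tensor_map K A I A (tensor K A V) id id (\<psi> F)
             = tensor_assoc K A A V (tensor_map K A V (tensor K A A) V \<Delta> id F)))"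

definition defines_right_corep ::
  "('k, 'm) ring_scheme \<Rightarrow> ('k, 'a, 'p) module_scheme
    \<Rightarrow> ('a \<Rightarrow> ('a \<times> 'a \<Rightarrow>\<^sub>0 int) set) \<Rightarrow> ('a \<Rightarrow> 'k) \<Rightarrow> ('k, 'v, 'r) module_scheme
    \<Rightarrow> ('k, ('v \<times> 'a \<Rightarrow>\<^sub>0 int) set, 's) module_scheme \<Rightarrow> bool" where
  "defines_right_corep K A \<Delta> \<epsilon> V I \<longleftrightarrow>
     (\<exists>!\<psi>. \<psi> \<in> extensional (carrier I) \<and> right_corep K A \<Delta> \<epsilon> I \<psi> \<and>
        (\<forall>F\<in>carrier I.
           tensor_assoc K V A A (tensor_map K I A (tensor K V A) A id id (\<psi> F))
             = tensor_map K V A V (tensor K A A) id \<Delta> F))"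

end

theory Submission
  imports Defs
begin

text \<open>
  For every vector space \<open>W\<close> let \<open>D\<^sub>W : A \<otimes> W \<rightarrow> A \<otimes> (A \<otimes> W)\<close> be \<open>\<Delta> \<otimes> id\<close> followed by reassociation. It
  is natural in \<open>W\<close> and coassociative, and it makes \<open>A \<otimes> W\<close> the cofree left corepresentation of \<open>A\<close> on
  \<open>W\<close>. The induced space \<open>I\<close> of \<open>\<rho> : V \<rightarrow> C \<otimes> V\<close> is the equalizer of two linear maps
  \<open>f, g : A \<otimes> V \<rightarrow> A \<otimes> (C \<otimes> V)\<close>, namely \<open>f = R \<otimes> id\<close> (reassociated) and \<open>g = id \<otimes> \<rho>\<close>.

  Both maps commute with \<open>D\<close>. Naturality gives \<open>(id \<otimes> g) D\<^sub>V = D\<^bsub>C \<otimes> V\<^esub> g\<close>. The map \<open>R = (id \<otimes> \<pi>) \<Delta>\<close>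
  applies \<open>\<pi>\<close> to the last leg of \<open>\<Delta>\<close> only, so coassociativity of \<open>\<Delta>\<close> gives
  \<open>(id \<otimes> f) D\<^sub>V = D\<^bsub>C \<otimes> V\<^esub> f\<close>. Hence \<open>id \<otimes> f\<close> and \<open>id \<otimes> g\<close> agree on \<open>D\<^sub>V F\<close> for every \<open>F\<close> in \<open>I\<close>.

  Over a field the functor \<open>A \<otimes> -\<close> preserves equalizers (\<open>tensor_equalizer_retraction_left\<close>).
  So \<open>A \<otimes> I \<rightarrow> A \<otimes> (A \<otimes> V)\<close> is injective and its image contains \<open>D\<^sub>V F\<close> for every \<open>F\<close> in \<open>I\<close>. This
  determines a unique map \<open>\<psi> : I \<rightarrow> A \<otimes> I\<close> over the restriction of \<open>D\<^sub>V\<close>, and the counit and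
  coassociativity laws for \<open>\<psi>\<close> follow from those for \<open>D\<close> by injectivity
  (\<open>equalizer_defines_left_corep\<close>). The preservation of equalizers rests on linear algebra in
  possibly infinite dimension: complements of subspaces exist by Zorn's lemma, so \<open>f - g\<close> has a
  generalized inverse \<open>s\<close>, and then \<open>1 - s (f - g)\<close> is a linear projection onto the equalizer. A
  projection stays a projection after tensoring with \<open>A\<close>.

  The right-handed half is the mirror image. There the natural map is
  \<open>V \<otimes> A \<rightarrow> (V \<otimes> A) \<otimes> A\<close>, so that the inverse of the associator takes the place of the associator.

  All identities between linear maps on tensor products are checked on pure tensors, which is
  legitimate by the universal property (\<open>tensor_linear_eqI\<close>).
\<close>

section \<open>Linear maps\<close>

lemma linear_mapI:
  assumes "vectorspace K V" "vectorspace K W"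
    and "\<And>v. v \<in> carrier V \<Longrightarrow> f v \<in> carrier W"
    and "\<And>v v'. v \<in> carrier V \<Longrightarrow> v' \<in> carrier V \<Longrightarrow> f (v \<oplus>\<^bsub>V\<^esub> v') = f v \<oplus>\<^bsub>W\<^esub> f v'"
    and "\<And>c v. c \<in> carrier K \<Longrightarrow> v \<in> carrier V \<Longrightarrow> f (c \<odot>\<^bsub>V\<^esub> v) = c \<odot>\<^bsub>W\<^esub> f v"
  shows "linear_map K V W f"
  using assms
  by (auto simp: linear_map_def mod_hom_def mod_hom_axioms_def module_hom_def vectorspace_def)

lemma linear_mapD:
  assumes "linear_map K V W f"
  shows "vectorspace K V" "vectorspace K W"
    and "\<And>v. v \<in> carrier V \<Longrightarrow> f v \<in> carrier W"
    and "\<And>v v'. v \<in> carrier V \<Longrightarrow> v' \<in> carrier V \<Longrightarrow> f (v \<oplus>\<^bsub>V\<^esub> v') = f v \<oplus>\<^bsub>W\<^esub> f v'"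
    and "\<And>c v. c \<in> carrier K \<Longrightarrow> v \<in> carrier V \<Longrightarrow> f (c \<odot>\<^bsub>V\<^esub> v) = c \<odot>\<^bsub>W\<^esub> f v"
  using assms
  by (auto simp: linear_map_def mod_hom_def mod_hom_axioms_def module_hom_def)

lemma linear_map_cong:
  assumes "linear_map K V W f" "\<And>v. v \<in> carrier V \<Longrightarrow> f v = g v"
  shows "linear_map K V W g"
proof -
  interpret vectorspace K V by (rule linear_mapD[OF assms(1)])
  show ?thesis
    using linear_mapD[OF assms(1)] assms(2) M.a_closed smult_closed
    by (intro linear_mapI) (metis)+
qed

lemma linear_map_compose:
  assumes "linear_map K U V f" "linear_map K V W g"
  shows "linear_map K U W (\<lambda>x. g (f x))"
  by (rule linear_mapI) (simp_all add: linear_mapD[OF assms(1)] linear_mapD[OF assms(2)])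

lemma linear_map_ident:
  assumes "vectorspace K V" shows "linear_map K V V (\<lambda>x. x)" "linear_map K V V id"
  by (rule linear_mapI; simp add: assms)+

lemma linear_map_add:
  assumes "linear_map K V W f" "linear_map K V W g"
  shows "linear_map K V W (\<lambda>x. f x \<oplus>\<^bsub>W\<^esub> g x)"
proof -
  interpret vectorspace K W by (rule linear_mapD[OF assms(1)])
  show ?thesis
    by (rule linear_mapI)
      (simp_all add: linear_mapD[OF assms(1)] linear_mapD[OF assms(2)] smult_r_distr M.a_ac)
qed

lemma linear_map_diff:
  assumes "linear_map K V W f" "linear_map K V W g"
  shows "linear_map K V W (\<lambda>x. f x \<ominus>\<^bsub>W\<^esub> g x)"
proof -
  interpret vectorspace K W by (rule linear_mapD[OF assms(1)])
  show ?thesis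
    by (rule linear_mapI)
      (simp_all add: linear_mapD[OF assms(1)] linear_mapD[OF assms(2)] smult_r_distr M.a_ac 
        a_minus_def M.minus_add smult_r_minus)
qed

lemma bilinear_mapI:
  assumes "vectorspace K U" "vectorspace K V" "vectorspace K W"
    and "\<And>u v. u \<in> carrier U \<Longrightarrow> v \<in> carrier V \<Longrightarrow> \<beta> u v \<in> carrier W"
    and "\<And>u u' v. u \<in> carrier U \<Longrightarrow> u' \<in> carrier U \<Longrightarrow> v \<in> carrier V \<Longrightarrow>
           \<beta> (u \<oplus>\<^bsub>U\<^esub> u') v = \<beta> u v \<oplus>\<^bsub>W\<^esub> \<beta> u' v"
    and "\<And>u v v'. u \<in> carrier U \<Longrightarrow> v \<in> carrier V \<Longrightarrow> v' \<in> carrier V \<Longrightarrow>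
           \<beta> u (v \<oplus>\<^bsub>V\<^esub> v') = \<beta> u v \<oplus>\<^bsub>W\<^esub> \<beta> u v'"
    and "\<And>c u v. c \<in> carrier K \<Longrightarrow> u \<in> carrier U \<Longrightarrow> v \<in> carrier V \<Longrightarrow>
           \<beta> (c \<odot>\<^bsub>U\<^esub> u) v = c \<odot>\<^bsub>W\<^esub> \<beta> u v"
    and "\<And>c u v. c \<in> carrier K \<Longrightarrow> u \<in> carrier U \<Longrightarrow> v \<in> carrier V \<Longrightarrow>
           \<beta> u (c \<odot>\<^bsub>V\<^esub> v) = c \<odot>\<^bsub>W\<^esub> \<beta> u v"
  shows "bilinear_map K U V W \<beta>"
  using assms unfolding bilinear_map_def by (auto intro!: linear_mapI)

section \<open>The tensor product of two vector spaces\<close>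

text \<open>
  The maps into a commutative group that factor through the tensor group. They are isolated from the
  bilinear maps because the universal property is already needed to define scalar multiplication of
  tensors, hence before the tensor group is a vector space.
\<close>

definition balanced ::
  "('k, 'm) ring_scheme \<Rightarrow> ('k, 'v, 'p) module_scheme \<Rightarrow> ('k, 'w, 'q) module_scheme
    \<Rightarrow> ('g, 'r) monoid_scheme \<Rightarrow> ('v \<Rightarrow> 'w \<Rightarrow> 'g) \<Rightarrow> bool" where
  "balanced K V W G \<beta> \<longleftrightarrow>
     (\<forall>v\<in>carrier V. \<forall>w\<in>carrier W. \<beta> v w \<in> carrier G) \<and>
     (\<forall>v\<in>carrier V. \<forall>v'\<in>carrier V. \<forall>w\<in>carrier W. \<beta> (v \<oplus>\<^bsub>V\<^esub> v') w = \<beta> v w \<otimes>\<^bsub>G\<^esub> \<beta> v' w) \<and>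
     (\<forall>v\<in>carrier V. \<forall>w\<in>carrier W. \<forall>w'\<in>carrier W. \<beta> v (w \<oplus>\<^bsub>W\<^esub> w') = \<beta> v w \<otimes>\<^bsub>G\<^esub> \<beta> v w') \<and>
     (\<forall>c\<in>carrier K. \<forall>v\<in>carrier V. \<forall>w\<in>carrier W. \<beta> (c \<odot>\<^bsub>V\<^esub> v) w = \<beta> v (c \<odot>\<^bsub>W\<^esub> w))"

context
  fixes K :: "('k, 'm) ring_scheme"
    and V :: "('k, 'v, 'p) module_scheme" and W :: "('k, 'w, 'q) module_scheme"
  assumes V: "vectorspace K V" and W: "vectorspace K W"
begin

interpretation V: vectorspace K V by (rule V)
interpretation W: vectorspace K W by (rule W)

private abbreviation (input) F where "F \<equiv> free_Abelian_group (carrier V \<times> carrier W)"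
private abbreviation (input) N where "N \<equiv> tensor_null K V W"
private abbreviation (input) T where "T \<equiv> tensor_group K V W"
private abbreviation (input) pure (infixl "\<otimes>\<^sub>p" 70) where "v \<otimes>\<^sub>p w \<equiv> pure_tensor K V W v w"

interpretation F: comm_group F by (rule abelian_free_Abelian_group)

lemma tensor_relators_subset: "tensor_relators K V W \<subseteq> carrier F"
proof -
  have k: "Poly_Mapping.keys (frag_of x - frag_of y) \<subseteq> carrier V \<times> carrier W"
    if "x \<in> carrier V \<times> carrier W" "y \<in> carrier V \<times> carrier W" for x y
    using keys_diff[of "frag_of x" "frag_of y"] that by auto
  moreover have "Poly_Mapping.keys (frag_of x - frag_of y - frag_of z) \<subseteq> carrier V \<times> carrier W"
    if "x \<in> carrier V \<times> carrier W" "y \<in> carrier V \<times> carrier W" "z \<in> carrier V \<times> carrier W" for x y z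
    using keys_diff[of "frag_of x - frag_of y" "frag_of z"] k[of x y] that by auto
  ultimately show ?thesis by (auto simp: tensor_relators_def)
qed

lemma tensor_null_normal: "N \<lhd> F"
  using F.generate_is_subgroup[OF tensor_relators_subset]
  by (simp add: F.normal_iff_subgroup tensor_null_def)

interpretation N: normal N F by (rule tensor_null_normal)

lemma tensor_group_comm_group: "comm_group T"
  unfolding tensor_group_def by (rule F.abelian_FactGroup) (rule N.subgroup_axioms)

interpretation T: comm_group T by (rule tensor_group_comm_group)

lemma tensor_coset_hom: "(\<lambda>a. N #>\<^bsub>F\<^esub> a) \<in> hom F T"
  unfolding tensor_group_def by (rule N.r_coset_hom_Mod)

lemma pure_tensor_in_group:
  "v \<in> carrier V \<Longrightarrow> w \<in> carrier W \<Longrightarrow> v \<otimes>\<^sub>p w \<in> carrier T"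
  unfolding pure_tensor_def using hom_carrier[OF tensor_coset_hom] by (auto simp: image_subset_iff)

lemma tensor_coset_eqI:
  assumes "a \<in> carrier F" "b \<in> carrier F" "a - b \<in> N"
  shows "N #>\<^bsub>F\<^esub> a = N #>\<^bsub>F\<^esub> b"
proof (rule F.coset_mult_inv1)
  have "a \<otimes>\<^bsub>F\<^esub> inv\<^bsub>F\<^esub> b = a - b" using assms by simp
  then show "N #>\<^bsub>F\<^esub> (a \<otimes>\<^bsub>F\<^esub> inv\<^bsub>F\<^esub> b) = N"
    using F.coset_join2 N.subgroup_axioms assms(3) N.mem_carrier by metis
qed (use assms N.subset in auto)

lemma relator_in_null: "x \<in> tensor_relators K V W \<Longrightarrow> x \<in> N"
  unfolding tensor_null_def by (rule generate.incl)

lemma tensor_coset_plus: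
  assumes "x \<in> carrier V \<times> carrier W" "y \<in> carrier V \<times> carrier W"
  shows "frag_of x + frag_of y \<in> carrier F"
    and "N #>\<^bsub>F\<^esub> (frag_of x + frag_of y) = (N #>\<^bsub>F\<^esub> frag_of x) \<otimes>\<^bsub>T\<^esub> (N #>\<^bsub>F\<^esub> frag_of y)"
proof -
  have xy: "frag_of x \<in> carrier F" "frag_of y \<in> carrier F" using assms by simp_all
  show "frag_of x + frag_of y \<in> carrier F" using F.m_closed[OF xy] by simp
  show "N #>\<^bsub>F\<^esub> (frag_of x + frag_of y) = (N #>\<^bsub>F\<^esub> frag_of x) \<otimes>\<^bsub>T\<^esub> (N #>\<^bsub>F\<^esub> frag_of y)"
    using hom_mult[OF tensor_coset_hom xy] by simp
qed

lemma pure_tensor_balanced: "balanced K V W T (\<lambda>v w. v \<otimes>\<^sub>p w)"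
proof -
  have 1: "(v \<oplus>\<^bsub>V\<^esub> v') \<otimes>\<^sub>p w = (v \<otimes>\<^sub>p w) \<otimes>\<^bsub>T\<^esub> (v' \<otimes>\<^sub>p w)"
    if "v \<in> carrier V" "v' \<in> carrier V" "w \<in> carrier W" for v v' w
  proof -
    have "frag_of (v \<oplus>\<^bsub>V\<^esub> v', w) - frag_of (v, w) - frag_of (v', w) \<in> N"
      by (rule relator_in_null) (use that in \<open>auto simp: tensor_relators_def\<close>)
    then show ?thesis
      using that tensor_coset_eqI[of "frag_of (v \<oplus>\<^bsub>V\<^esub> v', w)" "frag_of (v, w) + frag_of (v', w)"]
        tensor_coset_plus[of "(v, w)" "(v', w)"]
      by (simp add: pure_tensor_def diff_diff_eq)
  qed
  have 2: "v \<otimes>\<^sub>p (w \<oplus>\<^bsub>W\<^esub> w') = (v \<otimes>\<^sub>p w) \<otimes>\<^bsub>T\<^esub> (v \<otimes>\<^sub>p w')"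
    if "v \<in> carrier V" "w \<in> carrier W" "w' \<in> carrier W" for v w w'
  proof -
    have "frag_of (v, w \<oplus>\<^bsub>W\<^esub> w') - frag_of (v, w) - frag_of (v, w') \<in> N"
      by (rule relator_in_null) (use that in \<open>auto simp: tensor_relators_def\<close>)
    then show ?thesis
      using that tensor_coset_eqI[of "frag_of (v, w \<oplus>\<^bsub>W\<^esub> w')" "frag_of (v, w) + frag_of (v, w')"]
        tensor_coset_plus[of "(v, w)" "(v, w')"]
      by (simp add: pure_tensor_def diff_diff_eq)
  qed
  have 3: "(c \<odot>\<^bsub>V\<^esub> v) \<otimes>\<^sub>p w = v \<otimes>\<^sub>p (c \<odot>\<^bsub>W\<^esub> w)"
    if "c \<in> carrier K" "v \<in> carrier V" "w \<in> carrier W" for c v w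
    unfolding pure_tensor_def
    by (rule tensor_coset_eqI) (use that in \<open>auto simp: tensor_relators_def intro!: relator_in_null\<close>)
  show ?thesis
    using 1 2 3 pure_tensor_in_group by (auto simp: balanced_def)
qed

text \<open>
  Composed with the quotient map, both homomorphisms live on the free abelian group, where they are
  determined by the generators.
\<close>

lemma tensor_group_hom_eqI:
  assumes G: "group G" and h: "h \<in> hom T G" and k: "k \<in> hom T G"
    and eq: "\<And>v w. v \<in> carrier V \<Longrightarrow> w \<in> carrier W \<Longrightarrow> h (v \<otimes>\<^sub>p w) = k (v \<otimes>\<^sub>p w)"
    and t: "t \<in> carrier T"
  shows "h t = k t"
proof -
  let ?q = "\<lambda>a. N #>\<^bsub>F\<^esub> a"
  interpret h: group_hom F G "h \<circ> ?q"
    using Group.hom_compose[OF tensor_coset_hom h] G by (simp add: group_hom_def group_hom_axioms_def)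
  interpret k: group_hom F G "k \<circ> ?q"
    using Group.hom_compose[OF tensor_coset_hom k] G by (simp add: group_hom_def group_hom_axioms_def)
  from t obtain a where a: "a \<in> carrier F" "t = ?q a"
    unfolding tensor_group_def FactGroup_def RCOSETS_def by auto
  have "(h \<circ> ?q) a = (k \<circ> ?q) a"
  proof (rule free_Abelian_group_induct[of a "carrier V \<times> carrier W"])
    show "Poly_Mapping.keys a \<subseteq> carrier V \<times> carrier W" using a by simp
    show "(h \<circ> ?q) 0 = (k \<circ> ?q) 0" using h.hom_one k.hom_one by simp
    show "(h \<circ> ?q) (frag_of x) = (k \<circ> ?q) (frag_of x)" if "x \<in> carrier V \<times> carrier W" for x
      using that eq by (auto simp: pure_tensor_def)
    show "(h \<circ> ?q) (x - y) = (k \<circ> ?q) (x - y)"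
      if "Poly_Mapping.keys x \<subseteq> carrier V \<times> carrier W"
        "Poly_Mapping.keys y \<subseteq> carrier V \<times> carrier W"
        "(h \<circ> ?q) x = (k \<circ> ?q) x" "(h \<circ> ?q) y = (k \<circ> ?q) y" for x y
    proof -
      have F: "x \<in> carrier F" "y \<in> carrier F" using that by auto
      then have "x - y = x \<otimes>\<^bsub>F\<^esub> inv\<^bsub>F\<^esub> y" by simp
      then show ?thesis
        using that(3,4) h.hom_mult[OF F(1) F.inv_closed[OF F(2)]] h.hom_inv[OF F(2)]
          k.hom_mult[OF F(1) F.inv_closed[OF F(2)]] k.hom_inv[OF F(2)]
        by metis
    qed
  qed
  then show ?thesis using a by simp
qed

text \<open>
  Each family of relators expresses one clause of balancedness. So the homomorphism that \<open>\<beta>\<close> induces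
  on the free abelian group vanishes on the relators and descends to the quotient.
\<close>

lemma tensor_group_universal:
  assumes G: "comm_group G" and \<beta>: "balanced K V W G \<beta>"
  obtains h where "h \<in> hom T G"
    and "\<And>v w. v \<in> carrier V \<Longrightarrow> w \<in> carrier W \<Longrightarrow> h (v \<otimes>\<^sub>p w) = \<beta> v w"
proof -
  interpret G: comm_group G by (rule G)
  have "(\<lambda>(v, w). \<beta> v w) ` (carrier V \<times> carrier W) \<subseteq> carrier G"
    using \<beta> by (auto simp: balanced_def)
  then obtain f where f: "f \<in> hom F G"
    "\<And>x. x \<in> carrier V \<times> carrier W \<Longrightarrow> f (frag_of x) = (\<lambda>(v, w). \<beta> v w) x"
    using G.free_Abelian_group_universal by blast
  interpret f: group_hom F G f using f by unfold_locales
  have f2: "f (frag_of x - frag_of y) = f (frag_of x) \<otimes>\<^bsub>G\<^esub> inv\<^bsub>G\<^esub> f (frag_of y)"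
    if "x \<in> carrier V \<times> carrier W" "y \<in> carrier V \<times> carrier W" for x y
    using that f.hom_mult[of "frag_of x" "inv\<^bsub>F\<^esub> frag_of y"] f.hom_inv[of "frag_of y"] by simp
  have f3: "f (frag_of x - frag_of y - frag_of z) = \<one>\<^bsub>G\<^esub>"
    if x: "x \<in> carrier V \<times> carrier W" and y: "y \<in> carrier V \<times> carrier W"
      and z: "z \<in> carrier V \<times> carrier W"
      and eq: "f (frag_of x) = f (frag_of y) \<otimes>\<^bsub>G\<^esub> f (frag_of z)" for x y z
  proof -
    have "frag_of x - frag_of y \<in> carrier F"
      using F.m_closed[of "frag_of x" "inv\<^bsub>F\<^esub> frag_of y"] x y by simp
    then have "f (frag_of x - frag_of y - frag_of z)
        = (f (frag_of x) \<otimes>\<^bsub>G\<^esub> inv\<^bsub>G\<^esub> f (frag_of y)) \<otimes>\<^bsub>G\<^esub> inv\<^bsub>G\<^esub> f (frag_of z)"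
      using f.hom_mult[of "frag_of x - frag_of y" "inv\<^bsub>F\<^esub> frag_of z"] f.hom_inv[of "frag_of z"]
        f2[OF x y] z by simp
    moreover have "f (frag_of y) \<in> carrier G" "f (frag_of z) \<in> carrier G"
      using y z by (auto intro!: f.hom_closed)
    ultimately show ?thesis
      using eq by (simp add: G.m_assoc G.m_comm[of "f (frag_of y)"])
  qed
  have "tensor_relators K V W \<subseteq> kernel F G f"
  proof
    fix r assume r: "r \<in> tensor_relators K V W"
    then have "f r = \<one>\<^bsub>G\<^esub>"
      using \<beta> by (auto simp: tensor_relators_def balanced_def f(2) f2 intro!: f3)
    then show "r \<in> kernel F G f"
      using subsetD[OF tensor_relators_subset r] by (simp add: kernel_def)
  qed
  then have "N \<subseteq> kernel F G f"
    unfolding tensor_null_def by (rule F.generate_subgroup_incl) (rule f.subgroup_kernel)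
  then obtain h where h: "h \<in> hom (F Mod N) G" "\<And>x. x \<in> carrier F \<Longrightarrow> h (N #>\<^bsub>F\<^esub> x) = f x"
    using f.FactGroup_universal_kernel[OF tensor_null_normal] by blast
  show thesis
  proof (rule that)
    show "h \<in> hom T G" using h(1) by (simp add: tensor_group_def)
    show "h (v \<otimes>\<^sub>p w) = \<beta> v w" if "v \<in> carrier V" "w \<in> carrier W" for v w
      using that by (simp add: pure_tensor_def h(2) f(2))
  qed
qed

text \<open>
  The definite description in \<^const>\<open>tensor_lift\<close> denotes: existence is the universal property,
  and uniqueness holds because the maps considered are extensional.
\<close>

lemma tensor_lift_props:
  assumes G: "comm_group G" and \<beta>: "balanced K V W G \<beta>"
  shows "tensor_lift K V W G \<beta> \<in> hom T G"
    and "\<And>v w. v \<in> carrier V \<Longrightarrow> w \<in> carrier W \<Longrightarrow> tensor_lift K V W G \<beta> (v \<otimes>\<^sub>p w) = \<beta> v w"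
proof -
  obtain h where h: "h \<in> hom T G"
    "\<And>v w. v \<in> carrier V \<Longrightarrow> w \<in> carrier W \<Longrightarrow> h (v \<otimes>\<^sub>p w) = \<beta> v w"
    using tensor_group_universal[OF assms] by blast
  let ?P = "\<lambda>h. h \<in> extensional (carrier T) \<and> h \<in> hom T G \<and>
      (\<forall>v\<in>carrier V. \<forall>w\<in>carrier W. h (v \<otimes>\<^sub>p w) = \<beta> v w)"
  have 1: "?P (restrict h (carrier T))"
    using h pure_tensor_in_group by (auto simp: hom_def)
  have 2: "k = restrict h (carrier T)" if k: "?P k" for k
    using k 1 G tensor_group_hom_eqI[of G k "restrict h (carrier T)"]
    by (intro extensionalityI[of k "carrier T"]) (auto simp: comm_group_def)
  have "?P (tensor_lift K V W G \<beta>)"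
    unfolding tensor_lift_def by (rule theI[of ?P]) (rule 1, rule 2)
  then show "tensor_lift K V W G \<beta> \<in> hom T G"
    and "\<And>v w. v \<in> carrier V \<Longrightarrow> w \<in> carrier W \<Longrightarrow> tensor_lift K V W G \<beta> (v \<otimes>\<^sub>p w) = \<beta> v w"
    by blast+
qed

end

context
  fixes K :: "('k, 'm) ring_scheme"
    and V :: "('k, 'v, 'p) module_scheme" and W :: "('k, 'w, 'q) module_scheme"
  assumes V: "vectorspace K V" and W: "vectorspace K W"
begin

interpretation V: vectorspace K V by (rule V)
interpretation W: vectorspace K W by (rule W)
interpretation T: comm_group "tensor_group K V W" by (rule tensor_group_comm_group[OF V W])

text \<open>
  That \<open>v \<otimes> w \<mapsto> c v \<otimes> w\<close> respects the relation \<open>d v \<otimes> w = v \<otimes> d w\<close> is where commutativity of \<open>K\<close>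
  enters.
\<close>

lemma tensor_smult_props:
  assumes c: "c \<in> carrier K"
  shows "smult (tensor K V W) c \<in> hom (tensor_group K V W) (tensor_group K V W)"
    and "\<And>v w. v \<in> carrier V \<Longrightarrow> w \<in> carrier W \<Longrightarrow>
           c \<odot>\<^bsub>tensor K V W\<^esub> pure_tensor K V W v w = pure_tensor K V W (c \<odot>\<^bsub>V\<^esub> v) w"
proof -
  have "balanced K V W (tensor_group K V W) (\<lambda>v w. pure_tensor K V W (c \<odot>\<^bsub>V\<^esub> v) w)"
    using pure_tensor_balanced[OF V W] c
    by (simp add: balanced_def V.smult_r_distr W.smult_assoc1[symmetric] V.R.m_comm)
  note props = tensor_lift_props[OF V W tensor_group_comm_group[OF V W] this]
  show "smult (tensor K V W) c \<in> hom (tensor_group K V W) (tensor_group K V W)"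
    using props(1) by (simp add: tensor_def)
  show "\<And>v w. v \<in> carrier V \<Longrightarrow> w \<in> carrier W \<Longrightarrow>
      c \<odot>\<^bsub>tensor K V W\<^esub> pure_tensor K V W v w = pure_tensor K V W (c \<odot>\<^bsub>V\<^esub> v) w"
    using props(2) by (simp add: tensor_def)
qed

text \<open>
  Both sides of every module axiom are additive in the tensor, so they need only be compared on pure
  tensors.
\<close>

lemma tensor_vectorspace: "vectorspace K (tensor K V W)"
proof -
  let ?T = "tensor_group K V W"
  let ?s = "smult (tensor K V W)"
  note bal = pure_tensor_balanced[OF V W, unfolded balanced_def]
  note eqI = tensor_group_hom_eqI[OF V W T.is_group]
  have car: "carrier (tensor K V W) = carrier ?T"
    and add: "add (tensor K V W) = mult ?T" by (simp_all add: tensor_def fun_eq_iff)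
  have "abelian_group (tensor K V W)"
    by (rule abelian_groupI) (auto simp: tensor_def T.m_ac intro: T.l_inv_ex)
  moreover have "?s c t \<in> carrier ?T" if "c \<in> carrier K" "t \<in> carrier ?T" for c t
    using hom_carrier[OF tensor_smult_props(1)] that by auto
  moreover have "?s c (t \<otimes>\<^bsub>?T\<^esub> t') = ?s c t \<otimes>\<^bsub>?T\<^esub> ?s c t'"
    if "c \<in> carrier K" "t \<in> carrier ?T" "t' \<in> carrier ?T" for c t t'
    using hom_mult[OF tensor_smult_props(1)] that by auto
  moreover have "?s (c \<oplus>\<^bsub>K\<^esub> d) t = ?s c t \<otimes>\<^bsub>?T\<^esub> ?s d t"
    if cd: "c \<in> carrier K" "d \<in> carrier K" and t: "t \<in> carrier ?T" for c d t
  proof (rule eqI[OF tensor_smult_props(1) _ _ t])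
    show "(\<lambda>t. ?s c t \<otimes>\<^bsub>?T\<^esub> ?s d t) \<in> hom ?T ?T"
      using calculation(2,3) cd by (intro homI) (simp_all add: T.m_ac)
    show "?s (c \<oplus>\<^bsub>K\<^esub> d) (pure_tensor K V W v w)
        = ?s c (pure_tensor K V W v w) \<otimes>\<^bsub>?T\<^esub> ?s d (pure_tensor K V W v w)"
      if "v \<in> carrier V" "w \<in> carrier W" for v w
      using that cd bal by (simp add: tensor_smult_props V.smult_l_distr)
  qed (use cd in simp)
  moreover have "?s (c \<otimes>\<^bsub>K\<^esub> d) t = ?s c (?s d t)"
    if cd: "c \<in> carrier K" "d \<in> carrier K" and t: "t \<in> carrier ?T" for c d t
  proof (rule eqI[OF tensor_smult_props(1) _ _ t])
    show "(\<lambda>t. ?s c (?s d t)) \<in> hom ?T ?T"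
      using calculation(2,3) cd by (intro homI) simp_all
    show "?s (c \<otimes>\<^bsub>K\<^esub> d) (pure_tensor K V W v w) = ?s c (?s d (pure_tensor K V W v w))"
      if "v \<in> carrier V" "w \<in> carrier W" for v w
      using that cd by (simp add: tensor_smult_props V.smult_assoc1)
  qed (use cd in simp)
  moreover have "?s \<one>\<^bsub>K\<^esub> t = t" if t: "t \<in> carrier ?T" for t
    by (rule eqI[OF tensor_smult_props(1) _ _ t]) (simp_all add: homI tensor_smult_props(2))
  ultimately have "module K (tensor K V W)"
    by (intro moduleI V.R.is_cring) (simp_all add: car add)
  then show ?thesis
    by (simp add: vectorspace_def V.field_axioms)
qed

lemma pure_tensor_bilinear: "bilinear_map K V W (tensor K V W) (pure_tensor K V W)"
proof -
  note bal = pure_tensor_balanced[OF V W, unfolded balanced_def]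
  show ?thesis
  proof (rule bilinear_mapI[OF V W tensor_vectorspace])
    show "pure_tensor K V W v (c \<odot>\<^bsub>W\<^esub> w) = c \<odot>\<^bsub>tensor K V W\<^esub> pure_tensor K V W v w"
      if "c \<in> carrier K" "v \<in> carrier V" "w \<in> carrier W" for c v w
      using bal that by (simp add: tensor_smult_props(2))
    show "pure_tensor K V W (c \<odot>\<^bsub>V\<^esub> v) w = c \<odot>\<^bsub>tensor K V W\<^esub> pure_tensor K V W v w"
      if "c \<in> carrier K" "v \<in> carrier V" "w \<in> carrier W" for c v w
      using that by (simp add: tensor_smult_props(2))
  qed (use bal in \<open>simp_all add: tensor_def\<close>)
qed

lemma pure_tensor_closed [simp]:
  "v \<in> carrier V \<Longrightarrow> w \<in> carrier W \<Longrightarrow> pure_tensor K V W v w \<in> carrier (tensor K V W)"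
  using pure_tensor_in_group[OF V W] by (simp add: tensor_def)

lemma tensor_lift_linear_pure:
  assumes "bilinear_map K V W X \<beta>" and X: "vectorspace K X"
  shows "linear_map K (tensor K V W) X (tensor_lift K V W (add_monoid X) \<beta>)"
    and "\<And>v w. v \<in> carrier V \<Longrightarrow> w \<in> carrier W \<Longrightarrow>
           tensor_lift K V W (add_monoid X) \<beta> (pure_tensor K V W v w) = \<beta> v w"
proof -
  interpret X: vectorspace K X by (rule X)
  have l1: "linear_map K W X (\<beta> v)" if "v \<in> carrier V" for v
    using assms that by (simp add: bilinear_map_def)
  have l2: "linear_map K V X (\<lambda>v. \<beta> v w)" if "w \<in> carrier W" for w
    using assms that by (simp add: bilinear_map_def)
  have "balanced K V W (add_monoid X) \<beta>"
    by (simp add: balanced_def linear_mapD[OF l1] linear_mapD(4,5)[OF l2])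
  note props = tensor_lift_props[OF V W X.a_comm_group this]
  let ?h = "tensor_lift K V W (add_monoid X) \<beta>"
  show pure: "?h (pure_tensor K V W v w) = \<beta> v w" if "v \<in> carrier V" "w \<in> carrier W" for v w
    by (rule props(2)[OF that])
  have car: "carrier (tensor K V W) = carrier (tensor_group K V W)" by (simp add: tensor_def)
  have hcl: "?h t \<in> carrier X" if "t \<in> carrier (tensor_group K V W)" for t
    using hom_carrier[OF props(1)] that by auto
  have hadd: "?h (t \<otimes>\<^bsub>tensor_group K V W\<^esub> t') = ?h t \<oplus>\<^bsub>X\<^esub> ?h t'"
    if "t \<in> carrier (tensor_group K V W)" "t' \<in> carrier (tensor_group K V W)" for t t'
    using hom_mult[OF props(1) that] by simp
  show "linear_map K (tensor K V W) X ?h"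
  proof (rule linear_mapI[OF tensor_vectorspace X])
    fix c t assume c: "c \<in> carrier K" and t: "t \<in> carrier (tensor K V W)"
    note s = tensor_smult_props[OF c]
    show "?h (c \<odot>\<^bsub>tensor K V W\<^esub> t) = c \<odot>\<^bsub>X\<^esub> ?h t"
    proof (rule tensor_group_hom_eqI[OF V W X.a_group])
      show "(\<lambda>t. ?h (c \<odot>\<^bsub>tensor K V W\<^esub> t)) \<in> hom (tensor_group K V W) (add_monoid X)"
        using Group.hom_compose[OF s(1) props(1)] by (simp add: comp_def)
      show "(\<lambda>t. c \<odot>\<^bsub>X\<^esub> ?h t) \<in> hom (tensor_group K V W) (add_monoid X)"
        using c by (intro homI) (simp_all add: hcl hadd X.smult_r_distr)
      show "?h (c \<odot>\<^bsub>tensor K V W\<^esub> pure_tensor K V W v w) = c \<odot>\<^bsub>X\<^esub> ?h (pure_tensor K V W v w)"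
        if "v \<in> carrier V" "w \<in> carrier W" for v w
        using that c by (simp add: s(2) pure linear_mapD(5)[OF l2])
      show "t \<in> carrier (tensor_group K V W)" using t car by simp
    qed
  qed (use hcl hadd in \<open>auto simp: tensor_def\<close>)
qed

text \<open>
  The extensionality principle by which all identities below reduce to pure tensors.
\<close>

lemma tensor_linear_eqI:
  assumes f: "linear_map K (tensor K V W) X f" and g: "linear_map K (tensor K V W) X g"
    and eq: "\<And>v w. v \<in> carrier V \<Longrightarrow> w \<in> carrier W \<Longrightarrow>
               f (pure_tensor K V W v w) = g (pure_tensor K V W v w)"
    and t: "t \<in> carrier (tensor K V W)"
  shows "f t = g t"
proof -
  interpret X: vectorspace K X by (rule linear_mapD[OF f])
  have "h \<in> hom (tensor_group K V W) (add_monoid X)" if "linear_map K (tensor K V W) X h" for h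
    using linear_mapD(3,4)[OF that] by (intro homI) (simp_all add: tensor_def)
  from this[OF f] this[OF g] show ?thesis
    by (rule tensor_group_hom_eqI[OF V W X.a_group]) (use eq t in \<open>auto simp: tensor_def\<close>)
qed

end

section \<open>Tensor products of linear maps and associativity\<close>

lemma bilinear_map_compose:
  assumes "bilinear_map K U V X \<beta>" "linear_map K U' U f" "linear_map K V' V g" "linear_map K X Y h"
  shows "bilinear_map K U' V' Y (\<lambda>u v. h (\<beta> (f u) (g v)))"
  unfolding bilinear_map_def
proof (intro conjI ballI)
  fix u assume "u \<in> carrier U'"
  then have "linear_map K V X (\<beta> (f u))"
    using assms(1) linear_mapD(3)[OF assms(2)] by (simp add: bilinear_map_def)
  then show "linear_map K V' Y (\<lambda>v. h (\<beta> (f u) (g v)))"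
    by (rule linear_map_compose[OF linear_map_compose[OF assms(3)] assms(4)])
next
  fix v assume "v \<in> carrier V'"
  then have "linear_map K U X (\<lambda>u. \<beta> u (g v))"
    using assms(1) linear_mapD(3)[OF assms(3)] by (simp add: bilinear_map_def)
  then show "linear_map K U' Y (\<lambda>u. h (\<beta> (f u) (g v)))"
    by (rule linear_map_compose[OF linear_map_compose[OF assms(2)] assms(4)])
qed

lemma pure_tensor_linear:
  assumes "vectorspace K V" "vectorspace K W"
  shows "v \<in> carrier V \<Longrightarrow> linear_map K W (tensor K V W) (pure_tensor K V W v)"
    and "w \<in> carrier W \<Longrightarrow> linear_map K V (tensor K V W) (\<lambda>v. pure_tensor K V W v w)"
  using pure_tensor_bilinear[OF assms] by (simp_all add: bilinear_map_def)

lemma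
  assumes f: "linear_map K V V' f" and g: "linear_map K W W' g"
  shows tensor_map_linear:
      "linear_map K (tensor K V W) (tensor K V' W') (tensor_map K V W V' W' f g)"
    and tensor_map_pure: "\<And>v w. v \<in> carrier V \<Longrightarrow> w \<in> carrier W \<Longrightarrow>
      tensor_map K V W V' W' f g (pure_tensor K V W v w) = pure_tensor K V' W' (f v) (g w)"
proof -
  note V = linear_mapD(1,2)[OF f] and W = linear_mapD(1,2)[OF g]
  have "bilinear_map K V W (tensor K V' W') (\<lambda>v w. pure_tensor K V' W' (f v) (g w))"
    using bilinear_map_compose[OF pure_tensor_bilinear[OF V(2) W(2)] f g
        linear_map_ident(1)[OF tensor_vectorspace[OF V(2) W(2)]]] .
  note lift = tensor_lift_linear_pure[OF V(1) W(1) this tensor_vectorspace[OF V(2) W(2)]]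
  show "linear_map K (tensor K V W) (tensor K V' W') (tensor_map K V W V' W' f g)"
    and "\<And>v w. v \<in> carrier V \<Longrightarrow> w \<in> carrier W \<Longrightarrow>
      tensor_map K V W V' W' f g (pure_tensor K V W v w) = pure_tensor K V' W' (f v) (g w)"
    using lift by (simp_all add: tensor_map_def)
qed

lemma tensor_map_compose:
  assumes f: "linear_map K V V' f" and g: "linear_map K W W' g"
    and f': "linear_map K V' V'' f'" and g': "linear_map K W' W'' g'"
    and t: "t \<in> carrier (tensor K V W)"
  shows "tensor_map K V' W' V'' W'' f' g' (tensor_map K V W V' W' f g t)
    = tensor_map K V W V'' W'' (\<lambda>v. f' (f v)) (\<lambda>w. g' (g w)) t"
proof (rule tensor_linear_eqI[OF linear_mapD(1)[OF f] linear_mapD(1)[OF g] _ _ _ t])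
  note ff = linear_map_compose[OF f f'] and gg = linear_map_compose[OF g g']
  show "linear_map K (tensor K V W) (tensor K V'' W'')
      (\<lambda>t. tensor_map K V' W' V'' W'' f' g' (tensor_map K V W V' W' f g t))"
    by (rule linear_map_compose[OF tensor_map_linear[OF f g] tensor_map_linear[OF f' g']])
  show "linear_map K (tensor K V W) (tensor K V'' W'')
      (tensor_map K V W V'' W'' (\<lambda>v. f' (f v)) (\<lambda>w. g' (g w)))"
    by (rule tensor_map_linear[OF ff gg])
  show "tensor_map K V' W' V'' W'' f' g' (tensor_map K V W V' W' f g (pure_tensor K V W v w))
      = tensor_map K V W V'' W'' (\<lambda>v. f' (f v)) (\<lambda>w. g' (g w)) (pure_tensor K V W v w)"
    if "v \<in> carrier V" "w \<in> carrier W" for v w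
    using that
    by (simp add: tensor_map_pure[OF f g] tensor_map_pure[OF f' g'] tensor_map_pure[OF ff gg]
        linear_mapD(3)[OF f] linear_mapD(3)[OF g])
qed

lemma tensor_map_cong:
  assumes f: "linear_map K V V' f" and g: "linear_map K W W' g"
    and "\<And>v. v \<in> carrier V \<Longrightarrow> f v = f' v" "\<And>w. w \<in> carrier W \<Longrightarrow> g w = g' w"
    and t: "t \<in> carrier (tensor K V W)"
  shows "tensor_map K V W V' W' f g t = tensor_map K V W V' W' f' g' t"
proof (rule tensor_linear_eqI[OF linear_mapD(1)[OF f] linear_mapD(1)[OF g] _ _ _ t])
  have f': "linear_map K V V' f'" and g': "linear_map K W W' g'"
    using assms linear_map_cong by blast+
  show "linear_map K (tensor K V W) (tensor K V' W') (tensor_map K V W V' W' f g)"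
    "linear_map K (tensor K V W) (tensor K V' W') (tensor_map K V W V' W' f' g')"
    by (rule tensor_map_linear[OF f g], rule tensor_map_linear[OF f' g'])
  show "tensor_map K V W V' W' f g (pure_tensor K V W v w)
      = tensor_map K V W V' W' f' g' (pure_tensor K V W v w)"
    if "v \<in> carrier V" "w \<in> carrier W" for v w
    using that by (simp add: tensor_map_pure[OF f g] tensor_map_pure[OF f' g'] assms)
qed

lemma tensor_map_ident:
  assumes V: "vectorspace K V" and W: "vectorspace K W"
    and "\<And>v. v \<in> carrier V \<Longrightarrow> f v = v" "\<And>w. w \<in> carrier W \<Longrightarrow> g w = w"
    and t: "t \<in> carrier (tensor K V W)"
  shows "tensor_map K V W V W f g t = t"
proof (rule tensor_linear_eqI[OF V W _ _ _ t])
  have f: "linear_map K V V f" and g: "linear_map K W W g"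
    using assms linear_map_cong[OF linear_map_ident(1)] by metis+
  show "linear_map K (tensor K V W) (tensor K V W) (tensor_map K V W V W f g)"
    by (rule tensor_map_linear[OF f g])
  show "linear_map K (tensor K V W) (tensor K V W) (\<lambda>t. t)"
    by (rule linear_map_ident(1)[OF tensor_vectorspace[OF V W]])
  show "tensor_map K V W V W f g (pure_tensor K V W v w) = pure_tensor K V W v w"
    if "v \<in> carrier V" "w \<in> carrier W" for v w
    using that by (simp add: tensor_map_pure[OF f g] assms)
qed

text \<open>
  The associator is an iterated lift, so two layers of bilinearity must be verified. For fixed \<open>w\<close> the
  inner map is a lift, hence linear in \<open>t \<in> U \<otimes> V\<close>; its linearity in \<open>w\<close> is an identity between linear
  maps of \<open>t\<close>, and is checked on pure tensors.
\<close>

lemma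
  assumes U: "vectorspace K U" and V: "vectorspace K V" and W: "vectorspace K W"
  shows tensor_assoc_linear: "linear_map K (tensor K (tensor K U V) W) (tensor K U (tensor K V W))
      (tensor_assoc K U V W)"
    and tensor_assoc_pure: "\<And>u v w. u \<in> carrier U \<Longrightarrow> v \<in> carrier V \<Longrightarrow> w \<in> carrier W \<Longrightarrow>
      tensor_assoc K U V W (pure_tensor K (tensor K U V) W (pure_tensor K U V u v) w)
        = pure_tensor K U (tensor K V W) u (pure_tensor K V W v w)"
proof -
  let ?X = "tensor K U (tensor K V W)"
  let ?\<beta> = "\<lambda>w u v. pure_tensor K U (tensor K V W) u (pure_tensor K V W v w)"
  let ?l = "\<lambda>w. tensor_lift K U V (add_monoid ?X) (?\<beta> w)"
  note UV = tensor_vectorspace[OF U V] and VW = tensor_vectorspace[OF V W]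
  note X = tensor_vectorspace[OF U VW]
  have bil: "bilinear_map K U V ?X (?\<beta> w)" if "w \<in> carrier W" for w
    by (rule bilinear_map_compose[OF pure_tensor_bilinear[OF U VW] linear_map_ident(1)[OF U]
          pure_tensor_linear(2)[OF V W that] linear_map_ident(1)[OF X]])
  note l = tensor_lift_linear_pure[OF U V bil X]
  have lin: "linear_map K W ?X (\<lambda>w. ?\<beta> w u v)" if "u \<in> carrier U" "v \<in> carrier V" for u v
    using linear_map_compose[OF pure_tensor_linear(1)[OF V W that(2)]
        pure_tensor_linear(1)[OF U VW that(1)]] .
  interpret X: vectorspace K ?X by (rule X)
  interpret W: vectorspace K W by (rule W)
  have "bilinear_map K (tensor K U V) W ?X (\<lambda>t w. ?l w t)"
  proof (rule bilinear_mapI[OF UV W X])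
    fix t w assume t: "t \<in> carrier (tensor K U V)" and w: "w \<in> carrier W"
    show "?l w t \<in> carrier ?X"
      using linear_mapD(3)[OF l(1)] t w by blast
    show "?l w (t \<oplus>\<^bsub>tensor K U V\<^esub> t') = ?l w t \<oplus>\<^bsub>?X\<^esub> ?l w t'"
      if "t' \<in> carrier (tensor K U V)" for t'
      using linear_mapD(4)[OF l(1)] t w that by blast
    show "?l w (c \<odot>\<^bsub>tensor K U V\<^esub> t) = c \<odot>\<^bsub>?X\<^esub> ?l w t" if "c \<in> carrier K" for c
      using linear_mapD(5)[OF l(1)] t w that by blast
    show "?l (w \<oplus>\<^bsub>W\<^esub> w') t = ?l w t \<oplus>\<^bsub>?X\<^esub> ?l w' t" if w': "w' \<in> carrier W" for w'
    proof (rule tensor_linear_eqI[OF U V _ _ _ t])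
      show "linear_map K (tensor K U V) ?X (?l (w \<oplus>\<^bsub>W\<^esub> w'))"
        by (rule l(1)) (use w w' in simp)
      show "linear_map K (tensor K U V) ?X (\<lambda>t. ?l w t \<oplus>\<^bsub>?X\<^esub> ?l w' t)"
        by (rule linear_map_add[OF l(1)[OF w] l(1)[OF w']])
    qed (use w w' in \<open>simp_all add: l(2) linear_mapD(4)[OF lin]\<close>)
    show "?l (c \<odot>\<^bsub>W\<^esub> w) t = c \<odot>\<^bsub>?X\<^esub> ?l w t" if c: "c \<in> carrier K" for c
    proof (rule tensor_linear_eqI[OF U V _ _ _ t])
      show "linear_map K (tensor K U V) ?X (?l (c \<odot>\<^bsub>W\<^esub> w))"
        using w c by (intro l(1) W.smult_closed)
      show "linear_map K (tensor K U V) ?X (\<lambda>t. c \<odot>\<^bsub>?X\<^esub> ?l w t)"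
        using c by (intro linear_mapI[OF UV X])
          (simp_all add: linear_mapD[OF l(1)[OF w]] X.smult_r_distr X.smult_assoc1[symmetric]
            X.R.m_comm)
    qed (use w c in \<open>simp_all add: l(2) linear_mapD(5)[OF lin]\<close>)
  qed
  note lift = tensor_lift_linear_pure[OF UV W this X]
  show "linear_map K (tensor K (tensor K U V) W) ?X (tensor_assoc K U V W)"
    using lift(1) unfolding tensor_assoc_def .
  show "tensor_assoc K U V W (pure_tensor K (tensor K U V) W (pure_tensor K U V u v) w) = ?\<beta> w u v"
    if "u \<in> carrier U" "v \<in> carrier V" "w \<in> carrier W" for u v w
    using that unfolding tensor_assoc_def by (simp add: lift(2) l(2) pure_tensor_closed[OF U V])
qed

section \<open>Complements and generalized inverses\<close>

lemma subspaceI: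
  assumes "vectorspace K V" "N \<subseteq> carrier V" "\<zero>\<^bsub>V\<^esub> \<in> N"
    and "\<And>x y. x \<in> N \<Longrightarrow> y \<in> N \<Longrightarrow> x \<oplus>\<^bsub>V\<^esub> y \<in> N"
    and "\<And>c x. c \<in> carrier K \<Longrightarrow> x \<in> N \<Longrightarrow> c \<odot>\<^bsub>V\<^esub> x \<in> N"
  shows "subspace K N V"
  using assms by (auto simp: subspace_def submodule_def vectorspace_def)

lemma subspaceD:
  assumes "subspace K N V"
  shows "vectorspace K V" "N \<subseteq> carrier V" "\<zero>\<^bsub>V\<^esub> \<in> N"
    and "\<And>x y. x \<in> N \<Longrightarrow> y \<in> N \<Longrightarrow> x \<oplus>\<^bsub>V\<^esub> y \<in> N"
    and "\<And>c x. c \<in> carrier K \<Longrightarrow> x \<in> N \<Longrightarrow> c \<odot>\<^bsub>V\<^esub> x \<in> N"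
    and "\<And>x. x \<in> N \<Longrightarrow> \<ominus>\<^bsub>V\<^esub> x \<in> N"
    and "\<And>x y. x \<in> N \<Longrightarrow> y \<in> N \<Longrightarrow> x \<ominus>\<^bsub>V\<^esub> y \<in> N"
proof -
  show V: "vectorspace K V" and sub: "N \<subseteq> carrier V" and "\<zero>\<^bsub>V\<^esub> \<in> N"
    and add: "\<And>x y. x \<in> N \<Longrightarrow> y \<in> N \<Longrightarrow> x \<oplus>\<^bsub>V\<^esub> y \<in> N"
    and smult: "\<And>c x. c \<in> carrier K \<Longrightarrow> x \<in> N \<Longrightarrow> c \<odot>\<^bsub>V\<^esub> x \<in> N"
    using assms by (auto simp: subspace_def submodule_def)
  interpret vectorspace K V by (rule V)
  show neg: "\<ominus>\<^bsub>V\<^esub> x \<in> N" if "x \<in> N" for x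
    using smult[of "\<ominus>\<^bsub>K\<^esub> \<one>\<^bsub>K\<^esub>" x] that sub by (auto simp: smult_minus_1)
  show "x \<ominus>\<^bsub>V\<^esub> y \<in> N" if "x \<in> N" "y \<in> N" for x y
    using add neg that by (simp add: a_minus_def)
qed

lemma (in abelian_group) add_minus_cancel_left:
  assumes "a \<in> carrier G" "b \<in> carrier G"
  shows "(a \<oplus> b) \<ominus> a = b"
  using assms by (simp add: a_minus_def a_comm[of "a \<oplus> b"] r_neg1)

lemma (in abelian_group) minus_minus_cancel_left:
  assumes "y \<in> carrier G" "a \<in> carrier G" "b \<in> carrier G"
  shows "(y \<ominus> b) \<ominus> (y \<ominus> a) = a \<ominus> b"
proof -
  have "(y \<ominus> b) \<ominus> (y \<ominus> a) = \<ominus> y \<oplus> (y \<oplus> (a \<oplus> \<ominus> b))"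
    using assms by (simp add: a_minus_def minus_add a_ac)
  then show ?thesis using assms by (simp only: r_neg1 a_minus_def a_closed a_inv_closed)
qed

text \<open>
  Zorn's lemma yields a subspace \<open>N\<close> that is maximal among those meeting \<open>U\<close> only in zero. If \<open>x\<close> lies
  outside \<open>N\<close>, then adjoining \<open>x\<close> to \<open>N\<close> must create a nonzero vector \<open>u = n + c x\<close> of \<open>U\<close>; here
  \<open>c \<noteq> 0\<close>, and solving for \<open>x\<close> exhibits it in \<open>U + N\<close>.
\<close>

lemma subspace_complement:
  assumes U: "subspace K U V"
  obtains N where "subspace K N V" "U \<inter> N = {\<zero>\<^bsub>V\<^esub>}"
    and "\<And>x. x \<in> carrier V \<Longrightarrow> \<exists>u\<in>U. \<exists>n\<in>N. x = u \<oplus>\<^bsub>V\<^esub> n"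
proof -
  note U' = subspaceD[OF U]
  interpret vectorspace K V by (rule U'(1))
  let ?A = "{N. subspace K N V \<and> U \<inter> N = {\<zero>\<^bsub>V\<^esub>}}"
  have "{\<zero>\<^bsub>V\<^esub>} \<in> ?A"
    using U' by (auto intro!: subspaceI)
  moreover have "\<Union>\<C> \<in> ?A" if ne: "\<C> \<noteq> {}" and ch: "subset.chain ?A \<C>" for \<C>
  proof -
    have sub: "subspace K N V" "U \<inter> N = {\<zero>\<^bsub>V\<^esub>}" if "N \<in> \<C>" for N
      using ch that by (auto simp: subset_chain_def)
    have "subspace K (\<Union>\<C>) V"
    proof (rule subspaceI[OF U'(1)])
      fix x assume x: "x \<in> \<Union>\<C>"
      show "c \<odot>\<^bsub>V\<^esub> x \<in> \<Union>\<C>" if "c \<in> carrier K" for c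
        using x subspaceD(5)[OF sub(1) that] by blast
      fix y assume "y \<in> \<Union>\<C>"
      with x obtain N where "N \<in> \<C>" "x \<in> N" "y \<in> N"
        using ch by (force simp: subset_chain_def)
      then show "x \<oplus>\<^bsub>V\<^esub> y \<in> \<Union>\<C>" using subspaceD(4)[OF sub(1)] by blast
    next
      show "\<Union>\<C> \<subseteq> carrier V" using subspaceD(2)[OF sub(1)] by blast
      show "\<zero>\<^bsub>V\<^esub> \<in> \<Union>\<C>" using ne subspaceD(3)[OF sub(1)] by blast
    qed
    moreover have "U \<inter> \<Union>\<C> = {\<zero>\<^bsub>V\<^esub>}" using ne sub(2) by blast
    ultimately show ?thesis by simp
  qed
  ultimately have "\<exists>N\<in>?A. \<forall>X\<in>?A. N \<subseteq> X \<longrightarrow> X = N"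
    by (intro subset_Zorn_nonempty) auto
  then obtain N where N: "subspace K N V" "U \<inter> N = {\<zero>\<^bsub>V\<^esub>}"
    and max: "\<And>X. X \<in> ?A \<Longrightarrow> N \<subseteq> X \<Longrightarrow> X = N"
    by auto
  note N' = subspaceD[OF N(1)]
  show thesis
  proof (rule that[OF N])
    fix x assume x: "x \<in> carrier V"
    show "\<exists>u\<in>U. \<exists>n\<in>N. x = u \<oplus>\<^bsub>V\<^esub> n"
    proof (cases "x \<in> N")
      case True
      then show ?thesis using U'(3) x by (intro bexI[of _ "\<zero>\<^bsub>V\<^esub>"] bexI[of _ x]) auto
    next
      case False
      let ?X = "{n \<oplus>\<^bsub>V\<^esub> c \<odot>\<^bsub>V\<^esub> x | n c. n \<in> N \<and> c \<in> carrier K}"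
      have Nc: "n \<in> carrier V" if "n \<in> N" for n using that N'(2) by blast
      have "subspace K ?X V"
      proof (rule subspaceI[OF U'(1)])
        show "?X \<subseteq> carrier V" using Nc x by auto
        show "\<zero>\<^bsub>V\<^esub> \<in> ?X"
          using N'(3) x by (auto intro!: exI[of _ "\<zero>\<^bsub>V\<^esub>"] exI[of _ "\<zero>\<^bsub>K\<^esub>"])
        fix y assume "y \<in> ?X"
        then obtain n c where y: "y = n \<oplus>\<^bsub>V\<^esub> c \<odot>\<^bsub>V\<^esub> x" "n \<in> N" "c \<in> carrier K" by blast
        show "d \<odot>\<^bsub>V\<^esub> y \<in> ?X" if "d \<in> carrier K" for d
          using y that x N'(5) Nc
          by (auto simp: smult_r_distr smult_assoc1[symmetric]
              intro!: exI[of _ "d \<odot>\<^bsub>V\<^esub> n"] exI[of _ "d \<otimes>\<^bsub>K\<^esub> c"])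
        fix z assume "z \<in> ?X"
        then obtain m d where z: "z = m \<oplus>\<^bsub>V\<^esub> d \<odot>\<^bsub>V\<^esub> x" "m \<in> N" "d \<in> carrier K" by blast
        show "y \<oplus>\<^bsub>V\<^esub> z \<in> ?X"
          using y z x N'(4) Nc
          by (auto simp: smult_l_distr M.a_ac
              intro!: exI[of _ "n \<oplus>\<^bsub>V\<^esub> m"] exI[of _ "c \<oplus>\<^bsub>K\<^esub> d"])
      qed
      moreover have "N \<subseteq> ?X"
        using Nc x by (force intro: exI[of _ "\<zero>\<^bsub>K\<^esub>"])
      moreover have "x \<in> ?X"
        using N'(3) x by (auto intro!: exI[of _ "\<zero>\<^bsub>V\<^esub>"] exI[of _ "\<one>\<^bsub>K\<^esub>"])
      ultimately have "U \<inter> ?X \<noteq> {\<zero>\<^bsub>V\<^esub>}" "\<zero>\<^bsub>V\<^esub> \<in> ?X"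
        using max[of ?X] False N'(3) by auto
      then obtain u where "u \<in> U" "u \<in> ?X" "u \<noteq> \<zero>\<^bsub>V\<^esub>" using U'(3) by blast
      then obtain n c where u: "u \<in> U" "u \<noteq> \<zero>\<^bsub>V\<^esub>" "u = n \<oplus>\<^bsub>V\<^esub> c \<odot>\<^bsub>V\<^esub> x" "n \<in> N" "c \<in> carrier K"
        by blast
      have c: "c \<noteq> \<zero>\<^bsub>K\<^esub>"
      proof
        assume "c = \<zero>\<^bsub>K\<^esub>"
        then have "u = n" using u x Nc by simp
        then show False using u N(2) by blast
      qed
      have uc: "u \<in> carrier V" using u U'(2) by blast
      have ic: "inv\<^bsub>K\<^esub> c \<in> carrier K" using u c by simp
      have "c \<odot>\<^bsub>V\<^esub> x = u \<ominus>\<^bsub>V\<^esub> n"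
        using u(3,5) x Nc[OF u(4)]
        by (simp add: M.add_minus_cancel_left)
      then have "x = inv\<^bsub>K\<^esub> c \<odot>\<^bsub>V\<^esub> (u \<ominus>\<^bsub>V\<^esub> n)"
        using mult_inverse[OF u(5) x _ c] by simp
      also have "\<dots> = inv\<^bsub>K\<^esub> c \<odot>\<^bsub>V\<^esub> u \<oplus>\<^bsub>V\<^esub> inv\<^bsub>K\<^esub> c \<odot>\<^bsub>V\<^esub> (\<ominus>\<^bsub>V\<^esub> n)"
        using ic uc Nc[OF u(4)] by (simp add: a_minus_def smult_r_distr)
      finally show ?thesis using U'(5)[OF ic u(1)] N'(5)[OF ic N'(6)[OF u(4)]] by blast
    qed
  qed
qed

lemma linear_map_zero_diff:
  assumes "linear_map K V W f"
  shows "f \<zero>\<^bsub>V\<^esub> = \<zero>\<^bsub>W\<^esub>"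
    and "\<And>x y. x \<in> carrier V \<Longrightarrow> y \<in> carrier V \<Longrightarrow> f (x \<ominus>\<^bsub>V\<^esub> y) = f x \<ominus>\<^bsub>W\<^esub> f y"
proof -
  interpret linear_map K V W f by (rule assms)
  show "f \<zero>\<^bsub>V\<^esub> = \<zero>\<^bsub>W\<^esub>" by simp
  show "f (x \<ominus>\<^bsub>V\<^esub> y) = f x \<ominus>\<^bsub>W\<^esub> f y" if "x \<in> carrier V" "y \<in> carrier V" for x y
    using that by (rule f_minus)
qed

text \<open>
  Split \<open>V\<close> as the kernel of \<open>f\<close> plus \<open>N\<close>, and \<open>W\<close> as the image of \<open>f\<close> plus \<open>M\<close>. Then \<open>f\<close> maps \<open>N\<close>
  bijectively onto the image of \<open>f\<close>, and \<open>s\<close> inverts this bijection and vanishes on \<open>M\<close>.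
\<close>

lemma linear_map_generalized_inverse:
  assumes f: "linear_map K V W f"
  obtains s where "linear_map K W V s" "\<And>x. x \<in> carrier V \<Longrightarrow> f (s (f x)) = f x"
proof -
  note V = linear_mapD(1)[OF f] and W = linear_mapD(2)[OF f]
  interpret V: vectorspace K V by (rule V)
  interpret W: vectorspace K W by (rule W)
  interpret f: linear_map K V W f by (rule f)
  let ?Z = "{x \<in> carrier V. f x = \<zero>\<^bsub>W\<^esub>}"
  have Z: "subspace K ?Z V" and im: "subspace K (f ` carrier V) W"
    using f.kerT_is_subspace f.imT_is_subspace by (simp_all add: f.ker_def f.im_def)
  obtain N where N: "subspace K N V" "?Z \<inter> N = {\<zero>\<^bsub>V\<^esub>}"
    "\<And>x. x \<in> carrier V \<Longrightarrow> \<exists>u\<in>?Z. \<exists>n\<in>N. x = u \<oplus>\<^bsub>V\<^esub> n"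
    by (rule subspace_complement[OF Z]) blast
  obtain M where M: "subspace K M W" "f ` carrier V \<inter> M = {\<zero>\<^bsub>W\<^esub>}"
    "\<And>y. y \<in> carrier W \<Longrightarrow> \<exists>z\<in>f ` carrier V. \<exists>m\<in>M. y = z \<oplus>\<^bsub>W\<^esub> m"
    by (rule subspace_complement[OF im]) blast
  note N' = subspaceD[OF N(1)] and M' = subspaceD[OF M(1)]
  have Nc: "n \<in> carrier V" if "n \<in> N" for n using that N'(2) by blast
  have Mc: "m \<in> carrier W" if "m \<in> M" for m using that M'(2) by blast
  \<comment> \<open>\<open>P y n\<close> says that \<open>s y = n\<close>; the linearity of \<open>s\<close> then follows from uniqueness of \<open>n\<close>.\<close>
  define P where "P y n \<longleftrightarrow> n \<in> N \<and> y \<ominus>\<^bsub>W\<^esub> f n \<in> M" for y n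
  have ex: "\<exists>n. P y n" if y: "y \<in> carrier W" for y
  proof -
    obtain x m where x: "x \<in> carrier V" "m \<in> M" "y = f x \<oplus>\<^bsub>W\<^esub> m" using M(3)[OF y] by blast
    obtain u n where u: "u \<in> ?Z" "n \<in> N" "x = u \<oplus>\<^bsub>V\<^esub> n" using N(3)[OF x(1)] by blast
    have "f x = f n" using u Nc by simp
    then have "y \<ominus>\<^bsub>W\<^esub> f n = m"
      using x Nc[OF u(2)] Mc[OF x(2)]
      by (simp add: W.M.add_minus_cancel_left)
    then show ?thesis using u(2) x(2) by (auto simp: P_def)
  qed
  have un: "n = n'" if "P y n" "P y n'" and y: "y \<in> carrier W" for y n n'
  proof -
    have n: "n \<in> N" "n' \<in> N" and m: "y \<ominus>\<^bsub>W\<^esub> f n \<in> M" "y \<ominus>\<^bsub>W\<^esub> f n' \<in> M"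
      using that by (auto simp: P_def)
    have "f (n \<ominus>\<^bsub>V\<^esub> n') = (y \<ominus>\<^bsub>W\<^esub> f n') \<ominus>\<^bsub>W\<^esub> (y \<ominus>\<^bsub>W\<^esub> f n)"
      using n y Nc by (simp add: linear_map_zero_diff(2)[OF f] W.M.minus_minus_cancel_left)
    then have "f (n \<ominus>\<^bsub>V\<^esub> n') \<in> M"
      using M'(7)[OF m(2) m(1)] by metis
    moreover have nn: "n \<ominus>\<^bsub>V\<^esub> n' \<in> carrier V" using n Nc by simp
    ultimately have "f (n \<ominus>\<^bsub>V\<^esub> n') = \<zero>\<^bsub>W\<^esub>" using M(2) by blast
    then have "n \<ominus>\<^bsub>V\<^esub> n' \<in> ?Z \<inter> N" using nn N'(7)[OF n] by blast
    then have "n \<ominus>\<^bsub>V\<^esub> n' = \<zero>\<^bsub>V\<^esub>" using N(2) by blast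
    then show ?thesis using n Nc by simp
  qed
  define s where "s y = (SOME n. P y n)" for y
  have sP: "P y (s y)" if "y \<in> carrier W" for y
    unfolding s_def using ex[OF that] by (rule someI_ex)
  have seq: "s y = n" if "y \<in> carrier W" "P y n" for y n
    using un[OF sP[OF that(1)] that(2) that(1)] .
  show thesis
  proof (rule that)
    show "linear_map K W V s"
    proof (rule linear_mapI[OF W V])
      fix y assume y: "y \<in> carrier W"
      note Py = sP[OF y, unfolded P_def]
      show "s y \<in> carrier V" using Py Nc by blast
      show "s (y \<oplus>\<^bsub>W\<^esub> y') = s y \<oplus>\<^bsub>V\<^esub> s y'" if y': "y' \<in> carrier W" for y'
      proof (rule seq)
        note Py' = sP[OF y', unfolded P_def]
        have "(y \<oplus>\<^bsub>W\<^esub> y') \<ominus>\<^bsub>W\<^esub> f (s y \<oplus>\<^bsub>V\<^esub> s y') = (y \<ominus>\<^bsub>W\<^esub> f (s y)) \<oplus>\<^bsub>W\<^esub> (y' \<ominus>\<^bsub>W\<^esub> f (s y'))"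
          using y y' Py Py' Nc by (simp add: a_minus_def W.M.minus_add W.M.a_ac)
        then show "P (y \<oplus>\<^bsub>W\<^esub> y') (s y \<oplus>\<^bsub>V\<^esub> s y')"
          unfolding P_def using M'(4) N'(4) Py Py' by metis
      qed (use y y' in simp)
      show "s (c \<odot>\<^bsub>W\<^esub> y) = c \<odot>\<^bsub>V\<^esub> s y" if c: "c \<in> carrier K" for c
      proof (rule seq)
        have "(c \<odot>\<^bsub>W\<^esub> y) \<ominus>\<^bsub>W\<^esub> f (c \<odot>\<^bsub>V\<^esub> s y) = c \<odot>\<^bsub>W\<^esub> (y \<ominus>\<^bsub>W\<^esub> f (s y))"
          using y c Py Nc by (simp add: a_minus_def W.smult_r_distr W.smult_r_minus)
        then show "P (c \<odot>\<^bsub>W\<^esub> y) (c \<odot>\<^bsub>V\<^esub> s y)"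
          unfolding P_def using M'(5) N'(5) Py c by metis
      qed (use y c in simp)
    qed
    fix x assume x: "x \<in> carrier V"
    have "f (s (f x)) \<in> carrier W" "s (f x) \<in> carrier V"
      using sP[of "f x"] x Nc by (auto simp: P_def)
    moreover have "f x \<ominus>\<^bsub>W\<^esub> f (s (f x)) \<in> f ` carrier V \<inter> M"
    proof
      show "f x \<ominus>\<^bsub>W\<^esub> f (s (f x)) \<in> M" using sP[of "f x"] x by (simp add: P_def)
      show "f x \<ominus>\<^bsub>W\<^esub> f (s (f x)) \<in> f ` carrier V"
        using linear_map_zero_diff(2)[OF f x, of "s (f x)"] calculation x
        by (auto intro!: image_eqI[of _ f "x \<ominus>\<^bsub>V\<^esub> s (f x)"])
    qed
    ultimately show "f (s (f x)) = f x"
      using M(2) x W.M.minus_other_side[of "f x" "f (s (f x))"] by auto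
  qed
qed

section \<open>Tensoring preserves equalizers\<close>

text \<open>
  The induced spaces are literally of this form, with the operations of the ambient tensor product.
\<close>

definition equalizer ::
  "('k, 'v, 'p) module_scheme \<Rightarrow> ('v \<Rightarrow> 'w) \<Rightarrow> ('v \<Rightarrow> 'w) \<Rightarrow> ('k, 'v, 'p) module_scheme" where
  "equalizer W f g = W\<lparr>carrier := {w \<in> carrier W. f w = g w}\<rparr>"

lemma equalizer_sel [simp]:
  "w \<in> carrier (equalizer W f g) \<longleftrightarrow> w \<in> carrier W \<and> f w = g w"
  "add (equalizer W f g) = add W" "smult (equalizer W f g) = smult W"
  by (simp_all add: equalizer_def)

lemma equalizer_vectorspace:
  assumes f: "linear_map K W X f" and g: "linear_map K W X g"
  shows "vectorspace K (equalizer W f g)"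
proof -
  interpret vectorspace K W by (rule linear_mapD[OF f])
  have "subspace K {w \<in> carrier W. f w = g w} W"
    by (rule subspaceI[OF linear_mapD(1)[OF f]])
      (auto simp: linear_mapD[OF f] linear_mapD[OF g] linear_map_zero_diff[OF f]
        linear_map_zero_diff[OF g])
  then show ?thesis
    unfolding equalizer_def by (rule subspace_is_vs)
qed

lemma equalizer_inclusion:
  assumes f: "linear_map K W X f" and g: "linear_map K W X g"
  shows "linear_map K (equalizer W f g) W id"
  by (rule linear_mapI[OF equalizer_vectorspace[OF f g] linear_mapD(1)[OF f]]) simp_all

text \<open>
  With \<open>d = f - g\<close> and \<open>d s d = d\<close>, the map \<open>1 - s d\<close> takes values in the kernel of \<open>d\<close> because
  \<open>d (1 - s d) = 0\<close>. It is given by this formula, and not just as some linear projection, because the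
  formula survives tensoring: it shows that \<open>id \<otimes> (1 - s d)\<close> fixes every tensor killed by \<open>id \<otimes> d\<close>.
\<close>

lemma equalizer_projection:
  assumes f: "linear_map K W X f" and g: "linear_map K W X g"
  obtains s where "linear_map K X W s"
    and "linear_map K W (equalizer W f g) (\<lambda>w. w \<ominus>\<^bsub>W\<^esub> s (f w \<ominus>\<^bsub>X\<^esub> g w))"
proof -
  note W = linear_mapD(1)[OF f] and X = linear_mapD(2)[OF f]
  interpret W: vectorspace K W by (rule W)
  interpret X: vectorspace K X by (rule X)
  note d = linear_map_diff[OF f g]
  obtain s where s: "linear_map K X W s"
    "\<And>w. w \<in> carrier W \<Longrightarrow> f (s (f w \<ominus>\<^bsub>X\<^esub> g w)) \<ominus>\<^bsub>X\<^esub> g (s (f w \<ominus>\<^bsub>X\<^esub> g w)) = f w \<ominus>\<^bsub>X\<^esub> g w"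
    by (rule linear_map_generalized_inverse[OF d]) blast
  let ?p = "\<lambda>w. w \<ominus>\<^bsub>W\<^esub> s (f w \<ominus>\<^bsub>X\<^esub> g w)"
  have p: "linear_map K W W ?p"
    by (rule linear_map_diff[OF linear_map_ident(1)[OF W] linear_map_compose[OF d s(1)]])
  have "f (?p w) = g (?p w)" if w: "w \<in> carrier W" for w
  proof -
    have c: "f w \<ominus>\<^bsub>X\<^esub> g w \<in> carrier X" "s (f w \<ominus>\<^bsub>X\<^esub> g w) \<in> carrier W" "?p w \<in> carrier W"
      using linear_mapD(3)[OF d w] linear_mapD(3)[OF s(1)] linear_mapD(3)[OF p w] by auto
    have "f (?p w) \<ominus>\<^bsub>X\<^esub> g (?p w) = \<zero>\<^bsub>X\<^esub>"
      using linear_map_zero_diff(2)[OF d w c(2)] s(2)[OF w] c(1) by simp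
    then show ?thesis
      using X.minus_other_side[of "f (?p w)" "g (?p w)"] c(3)
      by (simp add: linear_mapD(3)[OF f] linear_mapD(3)[OF g])
  qed
  then have "linear_map K W (equalizer W f g) ?p"
    using linear_mapD[OF p] by (intro linear_mapI W equalizer_vectorspace[OF f g]) simp_all
  with s(1) show thesis by (rule that)
qed

text \<open>
  Preservation of the equalizer \<open>E\<close> by \<open>A \<otimes> -\<close>, in the form of a single linear map
  \<open>P = id \<otimes> (1 - s (f - g))\<close>. The second property of \<open>P\<close> makes \<open>A \<otimes> E \<rightarrow> A \<otimes> W\<close> injective; the third
  says that every tensor equalized by \<open>id \<otimes> f\<close> and \<open>id \<otimes> g\<close> comes from \<open>A \<otimes> E\<close>.
\<close>

lemma tensor_equalizer_retraction_left:
  assumes A: "vectorspace K A" and f: "linear_map K W X f" and g: "linear_map K W X g"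
  obtains P where "linear_map K (tensor K A W) (tensor K A (equalizer W f g)) P"
    and "\<And>t. t \<in> carrier (tensor K A (equalizer W f g)) \<Longrightarrow>
           P (tensor_map K A (equalizer W f g) A W id id t) = t"
    and "\<And>t. t \<in> carrier (tensor K A W) \<Longrightarrow>
           tensor_map K A W A X id f t = tensor_map K A W A X id g t \<Longrightarrow>
           tensor_map K A (equalizer W f g) A W id id (P t) = t"
proof -
  let ?E = "equalizer W f g"
  note W = linear_mapD(1)[OF f] and X = linear_mapD(2)[OF f] and E = equalizer_vectorspace[OF f g]
  note AW = tensor_vectorspace[OF A W] and AX = tensor_vectorspace[OF A X]
  note iA = linear_map_ident(2)[OF A] and iE = equalizer_inclusion[OF f g]
  interpret W: vectorspace K W by (rule W)
  interpret X: vectorspace K X by (rule X)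
  interpret AW: vectorspace K "tensor K A W" by (rule AW)
  interpret AX: vectorspace K "tensor K A X" by (rule AX)
  obtain s where s: "linear_map K X W s"
    and p: "linear_map K W ?E (\<lambda>w. w \<ominus>\<^bsub>W\<^esub> s (f w \<ominus>\<^bsub>X\<^esub> g w))"
    by (rule equalizer_projection[OF f g])
  let ?p = "\<lambda>w. w \<ominus>\<^bsub>W\<^esub> s (f w \<ominus>\<^bsub>X\<^esub> g w)"
  let ?P = "tensor_map K A W A ?E id ?p" and ?i = "tensor_map K A ?E A W id id"
  let ?f = "tensor_map K A W A X id f" and ?g = "tensor_map K A W A X id g"
    and ?s = "tensor_map K A X A W id s"
  note F = tensor_map_linear[OF iA f] and G = tensor_map_linear[OF iA g]
    and S = tensor_map_linear[OF iA s] and P = tensor_map_linear[OF iA p]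
  show thesis
  proof (rule that[OF P])
    fix t assume t: "t \<in> carrier (tensor K A ?E)"
    show "?P (?i t) = t"
      unfolding tensor_map_compose[OF iA iE iA p t]
      by (rule tensor_map_ident[OF A E _ _ t])
        (auto simp: a_minus_def X.M.r_neg linear_mapD(3)[OF g] linear_map_zero_diff(1)[OF s])
  next
    fix t assume t: "t \<in> carrier (tensor K A W)" and eq: "?f t = ?g t"
    have "?i (?P t) = t \<ominus>\<^bsub>tensor K A W\<^esub> ?s (?f t \<ominus>\<^bsub>tensor K A X\<^esub> ?g t)"
    proof (rule tensor_linear_eqI[OF A W _ _ _ t])
      show "linear_map K (tensor K A W) (tensor K A W) (\<lambda>t. ?i (?P t))"
        by (rule linear_map_compose[OF P tensor_map_linear[OF iA iE]])
      show "linear_map K (tensor K A W) (tensor K A W)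
          (\<lambda>t. t \<ominus>\<^bsub>tensor K A W\<^esub> ?s (?f t \<ominus>\<^bsub>tensor K A X\<^esub> ?g t))"
        by (rule linear_map_diff[OF linear_map_ident(1)[OF AW]
              linear_map_compose[OF linear_map_diff[OF F G] S]])
      fix a w assume a: "a \<in> carrier A" and w: "w \<in> carrier W"
      note lX = pure_tensor_linear(1)[OF A X a] and lW = pure_tensor_linear(1)[OF A W a]
      have c: "f w \<in> carrier X" "g w \<in> carrier X" "s (f w \<ominus>\<^bsub>X\<^esub> g w) \<in> carrier W" "?p w \<in> carrier ?E"
        using w by (simp_all add: linear_mapD(3)[OF f] linear_mapD(3)[OF g] linear_mapD(3)[OF s]
            linear_mapD(3)[OF p] del: equalizer_sel)
      show "?i (?P (pure_tensor K A W a w)) = pure_tensor K A W a w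
          \<ominus>\<^bsub>tensor K A W\<^esub> ?s (?f (pure_tensor K A W a w) \<ominus>\<^bsub>tensor K A X\<^esub> ?g (pure_tensor K A W a w))"
        using a w c
        by (simp add: tensor_map_pure[OF iA f] tensor_map_pure[OF iA g] tensor_map_pure[OF iA s]
            tensor_map_pure[OF iA p] tensor_map_pure[OF iA iE] linear_map_zero_diff(2)[OF lW]
            del: equalizer_sel flip: linear_map_zero_diff(2)[OF lX])
    qed
    then show "?i (?P t) = t"
      using t linear_mapD(3)[OF G t]
      by (simp add: eq a_minus_def AX.M.r_neg linear_map_zero_diff(1)[OF S])
  qed
qed

lemma tensor_equalizer_retraction_right:
  assumes A: "vectorspace K A" and f: "linear_map K W X f" and g: "linear_map K W X g"
  obtains P where "linear_map K (tensor K W A) (tensor K (equalizer W f g) A) P"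
    and "\<And>t. t \<in> carrier (tensor K (equalizer W f g) A) \<Longrightarrow>
           P (tensor_map K (equalizer W f g) A W A id id t) = t"
    and "\<And>t. t \<in> carrier (tensor K W A) \<Longrightarrow>
           tensor_map K W A X A f id t = tensor_map K W A X A g id t \<Longrightarrow>
           tensor_map K (equalizer W f g) A W A id id (P t) = t"
proof -
  let ?E = "equalizer W f g"
  note W = linear_mapD(1)[OF f] and X = linear_mapD(2)[OF f] and E = equalizer_vectorspace[OF f g]
  note WA = tensor_vectorspace[OF W A] and XA = tensor_vectorspace[OF X A]
  note iA = linear_map_ident(2)[OF A] and iE = equalizer_inclusion[OF f g]
  interpret W: vectorspace K W by (rule W)
  interpret X: vectorspace K X by (rule X)
  interpret WA: vectorspace K "tensor K W A" by (rule WA)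
  interpret XA: vectorspace K "tensor K X A" by (rule XA)
  obtain s where s: "linear_map K X W s"
    and p: "linear_map K W ?E (\<lambda>w. w \<ominus>\<^bsub>W\<^esub> s (f w \<ominus>\<^bsub>X\<^esub> g w))"
    by (rule equalizer_projection[OF f g])
  let ?p = "\<lambda>w. w \<ominus>\<^bsub>W\<^esub> s (f w \<ominus>\<^bsub>X\<^esub> g w)"
  let ?P = "tensor_map K W A ?E A ?p id" and ?i = "tensor_map K ?E A W A id id"
  let ?f = "tensor_map K W A X A f id" and ?g = "tensor_map K W A X A g id"
    and ?s = "tensor_map K X A W A s id"
  note F = tensor_map_linear[OF f iA] and G = tensor_map_linear[OF g iA]
    and S = tensor_map_linear[OF s iA] and P = tensor_map_linear[OF p iA]
  show thesis
  proof (rule that[OF P])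
    fix t assume t: "t \<in> carrier (tensor K ?E A)"
    show "?P (?i t) = t"
      unfolding tensor_map_compose[OF iE iA p iA t]
      by (rule tensor_map_ident[OF E A _ _ t])
        (auto simp: a_minus_def X.M.r_neg linear_mapD(3)[OF g] linear_map_zero_diff(1)[OF s])
  next
    fix t assume t: "t \<in> carrier (tensor K W A)" and eq: "?f t = ?g t"
    have "?i (?P t) = t \<ominus>\<^bsub>tensor K W A\<^esub> ?s (?f t \<ominus>\<^bsub>tensor K X A\<^esub> ?g t)"
    proof (rule tensor_linear_eqI[OF W A _ _ _ t])
      show "linear_map K (tensor K W A) (tensor K W A) (\<lambda>t. ?i (?P t))"
        by (rule linear_map_compose[OF P tensor_map_linear[OF iE iA]])
      show "linear_map K (tensor K W A) (tensor K W A)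
          (\<lambda>t. t \<ominus>\<^bsub>tensor K W A\<^esub> ?s (?f t \<ominus>\<^bsub>tensor K X A\<^esub> ?g t))"
        by (rule linear_map_diff[OF linear_map_ident(1)[OF WA]
              linear_map_compose[OF linear_map_diff[OF F G] S]])
      fix w a assume w: "w \<in> carrier W" and a: "a \<in> carrier A"
      note lX = pure_tensor_linear(2)[OF X A a] and lW = pure_tensor_linear(2)[OF W A a]
      have c: "f w \<in> carrier X" "g w \<in> carrier X" "s (f w \<ominus>\<^bsub>X\<^esub> g w) \<in> carrier W" "?p w \<in> carrier ?E"
        using w by (simp_all add: linear_mapD(3)[OF f] linear_mapD(3)[OF g] linear_mapD(3)[OF s]
            linear_mapD(3)[OF p] del: equalizer_sel)
      show "?i (?P (pure_tensor K W A w a)) = pure_tensor K W A w a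
          \<ominus>\<^bsub>tensor K W A\<^esub> ?s (?f (pure_tensor K W A w a) \<ominus>\<^bsub>tensor K X A\<^esub> ?g (pure_tensor K W A w a))"
        using a w c
        by (simp add: tensor_map_pure[OF f iA] tensor_map_pure[OF g iA] tensor_map_pure[OF s iA]
            tensor_map_pure[OF p iA] tensor_map_pure[OF iE iA] linear_map_zero_diff(2)[OF lW]
            del: equalizer_sel flip: linear_map_zero_diff(2)[OF lX])
    qed
    then show "?i (?P t) = t"
      using t linear_mapD(3)[OF G t]
      by (simp add: eq a_minus_def XA.M.r_neg linear_map_zero_diff(1)[OF S])
  qed
qed

section \<open>The inverse associator\<close>

definition tensor_swap ::
  "('k, 'm) ring_scheme \<Rightarrow> ('k, 'v, 'p) module_scheme \<Rightarrow> ('k, 'w, 'q) module_scheme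
    \<Rightarrow> ('v \<times> 'w \<Rightarrow>\<^sub>0 int) set \<Rightarrow> ('w \<times> 'v \<Rightarrow>\<^sub>0 int) set" where
  "tensor_swap K V W = tensor_lift K V W (add_monoid (tensor K W V)) (\<lambda>v w. pure_tensor K W V w v)"

lemma
  assumes V: "vectorspace K V" and W: "vectorspace K W"
  shows tensor_swap_linear: "linear_map K (tensor K V W) (tensor K W V) (tensor_swap K V W)"
    and tensor_swap_pure: "\<And>v w. v \<in> carrier V \<Longrightarrow> w \<in> carrier W \<Longrightarrow>
      tensor_swap K V W (pure_tensor K V W v w) = pure_tensor K W V w v"
proof -
  have "bilinear_map K V W (tensor K W V) (\<lambda>v w. pure_tensor K W V w v)"
    using pure_tensor_linear[OF W V] by (simp add: bilinear_map_def)
  note lift = tensor_lift_linear_pure[OF V W this tensor_vectorspace[OF W V]]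
  show "linear_map K (tensor K V W) (tensor K W V) (tensor_swap K V W)"
    and "\<And>v w. v \<in> carrier V \<Longrightarrow> w \<in> carrier W \<Longrightarrow>
      tensor_swap K V W (pure_tensor K V W v w) = pure_tensor K W V w v"
    using lift by (simp_all add: tensor_swap_def)
qed

text \<open>
  The inverse associator as a composite of swaps and one associator, from which it inherits linearity:
  \<open>u \<otimes> (v \<otimes> w) \<mapsto> (v \<otimes> w) \<otimes> u \<mapsto> (w \<otimes> v) \<otimes> u \<mapsto> w \<otimes> (v \<otimes> u) \<mapsto> (v \<otimes> u) \<otimes> w \<mapsto> (u \<otimes> v) \<otimes> w\<close>.
\<close>

definition tensor_assoc_inv ::
  "('k, 'm) ring_scheme \<Rightarrow> ('k, 'u, 'o) module_scheme \<Rightarrow> ('k, 'v, 'p) module_scheme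
    \<Rightarrow> ('k, 'w, 'q) module_scheme
    \<Rightarrow> ('u \<times> ('v \<times> 'w \<Rightarrow>\<^sub>0 int) set \<Rightarrow>\<^sub>0 int) set
    \<Rightarrow> (('u \<times> 'v \<Rightarrow>\<^sub>0 int) set \<times> 'w \<Rightarrow>\<^sub>0 int) set" where
  "tensor_assoc_inv K U V W t =
     tensor_map K (tensor K V U) W (tensor K U V) W (tensor_swap K V U) id
      (tensor_swap K W (tensor K V U)
       (tensor_assoc K W V U
        (tensor_map K (tensor K V W) U (tensor K W V) U (tensor_swap K V W) id
         (tensor_swap K U (tensor K V W) t))))"

lemma
  assumes U: "vectorspace K U" and V: "vectorspace K V" and W: "vectorspace K W"
  shows tensor_assoc_inv_linear: "linear_map K (tensor K U (tensor K V W)) (tensor K (tensor K U V) W)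
      (tensor_assoc_inv K U V W)"
    and tensor_assoc_inv_pure: "\<And>u v w. u \<in> carrier U \<Longrightarrow> v \<in> carrier V \<Longrightarrow> w \<in> carrier W \<Longrightarrow>
      tensor_assoc_inv K U V W (pure_tensor K U (tensor K V W) u (pure_tensor K V W v w))
        = pure_tensor K (tensor K U V) W (pure_tensor K U V u v) w"
proof -
  note vs = U V W tensor_vectorspace[OF V W] tensor_vectorspace[OF W V] tensor_vectorspace[OF V U]
  note l1 = tensor_swap_linear[OF vs(1,4)]
    and l2 = tensor_map_linear[OF tensor_swap_linear[OF V W] linear_map_ident(2)[OF U]]
    and l3 = tensor_assoc_linear[OF W V U]
    and l4 = tensor_swap_linear[OF vs(3,6)]
    and l5 = tensor_map_linear[OF tensor_swap_linear[OF V U] linear_map_ident(2)[OF W]]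
  have eq: "tensor_assoc_inv K U V W = (\<lambda>t.
     tensor_map K (tensor K V U) W (tensor K U V) W (tensor_swap K V U) id
      (tensor_swap K W (tensor K V U)
       (tensor_assoc K W V U
        (tensor_map K (tensor K V W) U (tensor K W V) U (tensor_swap K V W) id
         (tensor_swap K U (tensor K V W) t)))))"
    by (simp add: fun_eq_iff tensor_assoc_inv_def)
  show "linear_map K (tensor K U (tensor K V W)) (tensor K (tensor K U V) W)
      (tensor_assoc_inv K U V W)"
    unfolding eq
    by (rule linear_map_compose[OF linear_map_compose[OF linear_map_compose[OF
            linear_map_compose[OF l1 l2] l3] l4] l5])
  show "tensor_assoc_inv K U V W (pure_tensor K U (tensor K V W) u (pure_tensor K V W v w))
        = pure_tensor K (tensor K U V) W (pure_tensor K U V u v) w"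
    if "u \<in> carrier U" "v \<in> carrier V" "w \<in> carrier W" for u v w
    using that vs
    by (simp add: tensor_assoc_inv_def tensor_swap_pure tensor_assoc_pure linear_map_ident
        tensor_map_pure tensor_swap_linear)
qed

lemma tensor_assoc_linear_eqI:
  assumes U: "vectorspace K U" and V: "vectorspace K V" and W: "vectorspace K W"
    and f: "linear_map K (tensor K U (tensor K V W)) X f"
    and g: "linear_map K (tensor K U (tensor K V W)) X g"
    and eq: "\<And>u v w. u \<in> carrier U \<Longrightarrow> v \<in> carrier V \<Longrightarrow> w \<in> carrier W \<Longrightarrow>
      f (pure_tensor K U (tensor K V W) u (pure_tensor K V W v w))
      = g (pure_tensor K U (tensor K V W) u (pure_tensor K V W v w))"
    and t: "t \<in> carrier (tensor K U (tensor K V W))"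
  shows "f t = g t"
proof (rule tensor_linear_eqI[OF U tensor_vectorspace[OF V W] f g _ t])
  fix u s assume u: "u \<in> carrier U" and s: "s \<in> carrier (tensor K V W)"
  note l = pure_tensor_linear(1)[OF U tensor_vectorspace[OF V W] u]
  show "f (pure_tensor K U (tensor K V W) u s) = g (pure_tensor K U (tensor K V W) u s)"
    by (rule tensor_linear_eqI[OF V W linear_map_compose[OF l f] linear_map_compose[OF l g] _ s])
      (rule eq[OF u])
qed

lemma tensor_assoc_left_linear_eqI:
  assumes U: "vectorspace K U" and V: "vectorspace K V" and W: "vectorspace K W"
    and f: "linear_map K (tensor K (tensor K U V) W) X f"
    and g: "linear_map K (tensor K (tensor K U V) W) X g"
    and eq: "\<And>u v w. u \<in> carrier U \<Longrightarrow> v \<in> carrier V \<Longrightarrow> w \<in> carrier W \<Longrightarrow>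
      f (pure_tensor K (tensor K U V) W (pure_tensor K U V u v) w)
      = g (pure_tensor K (tensor K U V) W (pure_tensor K U V u v) w)"
    and t: "t \<in> carrier (tensor K (tensor K U V) W)"
  shows "f t = g t"
proof (rule tensor_linear_eqI[OF tensor_vectorspace[OF U V] W f g _ t])
  fix s w assume s: "s \<in> carrier (tensor K U V)" and w: "w \<in> carrier W"
  note l = pure_tensor_linear(2)[OF tensor_vectorspace[OF U V] W w]
  show "f (pure_tensor K (tensor K U V) W s w) = g (pure_tensor K (tensor K U V) W s w)"
    by (rule tensor_linear_eqI[OF U V linear_map_compose[OF l f] linear_map_compose[OF l g] _ s])
      (rule eq[OF _ _ w])
qed

lemma tensor_assoc_inverse:
  assumes U: "vectorspace K U" and V: "vectorspace K V" and W: "vectorspace K W"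
  shows "t \<in> carrier (tensor K U (tensor K V W)) \<Longrightarrow>
      tensor_assoc K U V W (tensor_assoc_inv K U V W t) = t"
    and "s \<in> carrier (tensor K (tensor K U V) W) \<Longrightarrow>
      tensor_assoc_inv K U V W (tensor_assoc K U V W s) = s"
proof -
  note a = tensor_assoc_linear[OF U V W] and b = tensor_assoc_inv_linear[OF U V W]
  note p = tensor_assoc_pure[OF U V W] and q = tensor_assoc_inv_pure[OF U V W]
  show "tensor_assoc K U V W (tensor_assoc_inv K U V W t) = t"
    if "t \<in> carrier (tensor K U (tensor K V W))"
    by (rule tensor_assoc_linear_eqI[OF U V W linear_map_compose[OF b a]
          linear_map_ident(1)[OF linear_mapD(1)[OF b]] _ that]) (simp add: p q)
  show "tensor_assoc_inv K U V W (tensor_assoc K U V W s) = s"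
    if "s \<in> carrier (tensor K (tensor K U V) W)"
    by (rule tensor_assoc_left_linear_eqI[OF U V W linear_map_compose[OF a b]
          linear_map_ident(1)[OF linear_mapD(1)[OF a]] _ that]) (simp add: p q)
qed

section \<open>Expanding one tensor factor\<close>

text \<open>
  For \<open>f = \<Delta>\<close> this is the cofree coaction on \<open>A \<otimes> W\<close>, and for \<open>f = R\<close> it is the map \<open>R \<otimes> id\<close> in the
  definition of the induced space. Treating both at once lets one compatibility statement serve
  coassociativity and the invariance of the induced space.
\<close>

definition expand_left ::
  "('k, 'm) ring_scheme \<Rightarrow> ('k, 'a, 'p) module_scheme \<Rightarrow> ('k, 'x, 'o) module_scheme
    \<Rightarrow> ('k, 'y, 'q) module_scheme \<Rightarrow> ('a \<Rightarrow> ('x \<times> 'y \<Rightarrow>\<^sub>0 int) set)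
    \<Rightarrow> ('k, 'w, 'r) module_scheme
    \<Rightarrow> ('a \<times> 'w \<Rightarrow>\<^sub>0 int) set \<Rightarrow> ('x \<times> ('y \<times> 'w \<Rightarrow>\<^sub>0 int) set \<Rightarrow>\<^sub>0 int) set" where
  "expand_left K A X Y f W t =
     tensor_assoc K X Y W (tensor_map K A W (tensor K X Y) W f id t)"

definition expand_right ::
  "('k, 'm) ring_scheme \<Rightarrow> ('k, 'a, 'p) module_scheme \<Rightarrow> ('k, 'x, 'o) module_scheme
    \<Rightarrow> ('k, 'y, 'q) module_scheme \<Rightarrow> ('a \<Rightarrow> ('x \<times> 'y \<Rightarrow>\<^sub>0 int) set)
    \<Rightarrow> ('k, 'w, 'r) module_scheme
    \<Rightarrow> ('w \<times> 'a \<Rightarrow>\<^sub>0 int) set \<Rightarrow> (('w \<times> 'x \<Rightarrow>\<^sub>0 int) set \<times> 'y \<Rightarrow>\<^sub>0 int) set" where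
  "expand_right K A X Y f W t =
     tensor_assoc_inv K W X Y (tensor_map K W A W (tensor K X Y) id f t)"

lemma
  assumes f: "linear_map K A (tensor K X Y) f" and X: "vectorspace K X" and Y: "vectorspace K Y"
    and W: "vectorspace K W"
  shows expand_left_linear:
      "linear_map K (tensor K A W) (tensor K X (tensor K Y W)) (expand_left K A X Y f W)"
    and expand_left_pure: "\<And>a w. a \<in> carrier A \<Longrightarrow> w \<in> carrier W \<Longrightarrow>
      expand_left K A X Y f W (pure_tensor K A W a w)
        = tensor_assoc K X Y W (pure_tensor K (tensor K X Y) W (f a) w)"
    and expand_right_linear:
      "linear_map K (tensor K W A) (tensor K (tensor K W X) Y) (expand_right K A X Y f W)"
    and expand_right_pure: "\<And>a w. a \<in> carrier A \<Longrightarrow> w \<in> carrier W \<Longrightarrow>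
      expand_right K A X Y f W (pure_tensor K W A w a)
        = tensor_assoc_inv K W X Y (pure_tensor K W (tensor K X Y) w (f a))"
proof -
  note i = linear_map_ident(2)[OF W]
  show "linear_map K (tensor K A W) (tensor K X (tensor K Y W)) (expand_left K A X Y f W)"
    using linear_map_compose[OF tensor_map_linear[OF f i] tensor_assoc_linear[OF X Y W]]
    by (simp add: expand_left_def[abs_def])
  show "linear_map K (tensor K W A) (tensor K (tensor K W X) Y) (expand_right K A X Y f W)"
    using linear_map_compose[OF tensor_map_linear[OF i f] tensor_assoc_inv_linear[OF W X Y]]
    by (simp add: expand_right_def[abs_def])
qed (simp_all add: expand_left_def expand_right_def tensor_map_pure[OF f linear_map_ident(2)[OF W]]
      tensor_map_pure[OF linear_map_ident(2)[OF W] f])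

text \<open>
  The two operations act on different tensor factors.
\<close>

lemma expand_left_natural:
  assumes f: "linear_map K A (tensor K X Y) f" and X: "vectorspace K X" and Y: "vectorspace K Y"
    and h: "linear_map K W W' h" and t: "t \<in> carrier (tensor K A W)"
  shows "tensor_map K X (tensor K Y W) X (tensor K Y W') id (tensor_map K Y W Y W' id h)
        (expand_left K A X Y f W t)
      = expand_left K A X Y f W' (tensor_map K A W A W' id h t)"
proof -
  note A = linear_mapD(1)[OF f] and W = linear_mapD(1,2)[OF h] and XY = linear_mapD(2)[OF f]
  note iA = linear_map_ident(2)[OF A] and iX = linear_map_ident(2)[OF X]
    and iY = linear_map_ident(2)[OF Y]
  note Yh = tensor_map_linear[OF iY h] and XYh = tensor_map_linear[OF iX tensor_map_linear[OF iY h]]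
  have key: "tensor_map K X (tensor K Y W) X (tensor K Y W') id (tensor_map K Y W Y W' id h)
        (tensor_assoc K X Y W (pure_tensor K (tensor K X Y) W s w))
      = tensor_assoc K X Y W' (pure_tensor K (tensor K X Y) W' s (h w))"
    if w: "w \<in> carrier W" and s: "s \<in> carrier (tensor K X Y)" for s w
    by (rule tensor_linear_eqI[OF X Y
          linear_map_compose[OF linear_map_compose[OF pure_tensor_linear(2)[OF XY W(1) w]
              tensor_assoc_linear[OF X Y W(1)]] XYh]
          linear_map_compose[OF pure_tensor_linear(2)[OF XY W(2) linear_mapD(3)[OF h w]]
            tensor_assoc_linear[OF X Y W(2)]] _ s])
      (simp add: w linear_mapD(3)[OF h] tensor_assoc_pure X Y W tensor_map_pure[OF iX Yh]
        tensor_map_pure[OF iY h])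
  show ?thesis
    by (rule tensor_linear_eqI[OF A W(1)
          linear_map_compose[OF expand_left_linear[OF f X Y W(1)] XYh]
          linear_map_compose[OF tensor_map_linear[OF iA h] expand_left_linear[OF f X Y W(2)]] _ t])
      (simp add: expand_left_pure[OF f X Y] W tensor_map_pure[OF iA h] key linear_mapD(3)[OF h]
        linear_mapD(3)[OF f])
qed

lemma expand_right_natural:
  assumes f: "linear_map K A (tensor K X Y) f" and X: "vectorspace K X" and Y: "vectorspace K Y"
    and h: "linear_map K W W' h" and t: "t \<in> carrier (tensor K W A)"
  shows "tensor_map K (tensor K W X) Y (tensor K W' X) Y (tensor_map K W X W' X h id) id
        (expand_right K A X Y f W t)
      = expand_right K A X Y f W' (tensor_map K W A W' A h id t)"
proof -
  note A = linear_mapD(1)[OF f] and W = linear_mapD(1,2)[OF h] and XY = linear_mapD(2)[OF f]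
  note iA = linear_map_ident(2)[OF A] and iX = linear_map_ident(2)[OF X]
    and iY = linear_map_ident(2)[OF Y]
  note hX = tensor_map_linear[OF h iX] and hXY = tensor_map_linear[OF tensor_map_linear[OF h iX] iY]
  have key: "tensor_map K (tensor K W X) Y (tensor K W' X) Y (tensor_map K W X W' X h id) id
        (tensor_assoc_inv K W X Y (pure_tensor K W (tensor K X Y) w s))
      = tensor_assoc_inv K W' X Y (pure_tensor K W' (tensor K X Y) (h w) s)"
    if w: "w \<in> carrier W" and s: "s \<in> carrier (tensor K X Y)" for s w
    by (rule tensor_linear_eqI[OF X Y
          linear_map_compose[OF linear_map_compose[OF pure_tensor_linear(1)[OF W(1) XY w]
              tensor_assoc_inv_linear[OF W(1) X Y]] hXY]
          linear_map_compose[OF pure_tensor_linear(1)[OF W(2) XY linear_mapD(3)[OF h w]]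
            tensor_assoc_inv_linear[OF W(2) X Y]] _ s])
      (simp add: w linear_mapD(3)[OF h] tensor_assoc_inv_pure X Y W tensor_map_pure[OF hX iY]
        tensor_map_pure[OF h iX])
  show ?thesis
    by (rule tensor_linear_eqI[OF W(1) A
          linear_map_compose[OF expand_right_linear[OF f X Y W(1)] hXY]
          linear_map_compose[OF tensor_map_linear[OF h iA] expand_right_linear[OF f X Y W(2)]] _ t])
      (simp add: expand_right_pure[OF f X Y] W tensor_map_pure[OF h iA] key linear_mapD(3)[OF h]
        linear_mapD(3)[OF f])
qed

text \<open>
  A coassociativity law \<open>(q \<otimes> id) p = (id \<otimes> u) r\<close> between maps out of \<open>A\<close> is inherited by \<open>A \<otimes> W\<close>. The
  idea is to fix \<open>w\<close> and to consider the linear map \<open>E\<close> that appends \<open>w\<close> at the far right of a threefold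
  tensor. On \<open>a \<otimes> w\<close>, the left side is \<open>E\<close> applied to \<open>(q \<otimes> id) (p a)\<close> and the right side is \<open>E\<close>
  applied to \<open>(id \<otimes> u) (r a)\<close>.
\<close>

lemma expand_left_expand_left:
  assumes p: "linear_map K A (tensor K B C) p" and q: "linear_map K B (tensor K X Y) q"
    and r: "linear_map K A (tensor K X D) r" and u: "linear_map K D (tensor K Y C) u"
    and C: "vectorspace K C" and X: "vectorspace K X" and Y: "vectorspace K Y"
    and W: "vectorspace K W"
    and eq: "\<And>a. a \<in> carrier A \<Longrightarrow>
      expand_left K B X Y q C (p a) = tensor_map K X D X (tensor K Y C) id u (r a)"
    and t: "t \<in> carrier (tensor K A W)"
  shows "expand_left K B X Y q (tensor K C W) (expand_left K A B C p W t)
    = tensor_map K X (tensor K D W) X (tensor K Y (tensor K C W)) id (expand_left K D Y C u W)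
        (expand_left K A X D r W t)"
proof -
  note A = linear_mapD(1)[OF p] and B = linear_mapD(1)[OF q] and D = linear_mapD(1)[OF u]
  note CW = tensor_vectorspace[OF C W] and YC = tensor_vectorspace[OF Y C]
    and XY = tensor_vectorspace[OF X Y] and BC = tensor_vectorspace[OF B C]
    and XD = tensor_vectorspace[OF X D]
  note iX = linear_map_ident(2)[OF X]
  note U = expand_left_linear[OF u Y C W] and Q = expand_left_linear[OF q X Y CW]
    and Q' = expand_left_linear[OF q X Y C]
  show ?thesis
  proof (rule tensor_linear_eqI[OF A W _ _ _ t])
    show "linear_map K (tensor K A W) (tensor K X (tensor K Y (tensor K C W)))
        (\<lambda>t. expand_left K B X Y q (tensor K C W) (expand_left K A B C p W t))"
      by (rule linear_map_compose[OF expand_left_linear[OF p B C W] Q])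
    show "linear_map K (tensor K A W) (tensor K X (tensor K Y (tensor K C W)))
        (\<lambda>t. tensor_map K X (tensor K D W) X (tensor K Y (tensor K C W)) id
          (expand_left K D Y C u W) (expand_left K A X D r W t))"
      by (rule linear_map_compose[OF expand_left_linear[OF r X D W] tensor_map_linear[OF iX U]])
    fix a w assume a: "a \<in> carrier A" and w: "w \<in> carrier W"
    let ?e = "\<lambda>z. tensor_assoc K Y C W (pure_tensor K (tensor K Y C) W z w)"
    let ?E = "tensor_map K X (tensor K Y C) X (tensor K Y (tensor K C W)) id ?e"
    have e: "linear_map K (tensor K Y C) (tensor K Y (tensor K C W)) ?e"
      by (rule linear_map_compose[OF pure_tensor_linear(2)[OF YC W w] tensor_assoc_linear[OF Y C W]])
    note E = tensor_map_linear[OF iX e]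
    have 1: "?E (tensor_assoc K X Y C (pure_tensor K (tensor K X Y) C s c))
        = tensor_assoc K X Y (tensor K C W)
            (pure_tensor K (tensor K X Y) (tensor K C W) s (pure_tensor K C W c w))"
      if c: "c \<in> carrier C" and s: "s \<in> carrier (tensor K X Y)" for s c
    proof -
      have cw: "pure_tensor K C W c w \<in> carrier (tensor K C W)"
        using c w C W by simp
      show ?thesis
        by (rule tensor_linear_eqI[OF X Y
              linear_map_compose[OF linear_map_compose[OF pure_tensor_linear(2)[OF XY C c]
                tensor_assoc_linear[OF X Y C]] E]
              linear_map_compose[OF pure_tensor_linear(2)[OF XY CW cw]
                tensor_assoc_linear[OF X Y CW]] _ s])
          (simp add: c w C W X Y CW tensor_assoc_pure tensor_map_pure[OF iX e])
    qed
    have 2: "expand_left K B X Y q (tensor K C W)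
          (tensor_assoc K B C W (pure_tensor K (tensor K B C) W s w))
        = ?E (expand_left K B X Y q C s)" if s: "s \<in> carrier (tensor K B C)" for s
      by (rule tensor_linear_eqI[OF B C
            linear_map_compose[OF linear_map_compose[OF pure_tensor_linear(2)[OF BC W w]
              tensor_assoc_linear[OF B C W]] Q] linear_map_compose[OF Q' E] _ s])
        (simp add: w tensor_assoc_pure B C W CW expand_left_pure[OF q X Y] 1 linear_mapD(3)[OF q])
    have 3: "?E (tensor_map K X D X (tensor K Y C) id u s)
        = tensor_map K X (tensor K D W) X (tensor K Y (tensor K C W)) id (expand_left K D Y C u W)
            (tensor_assoc K X D W (pure_tensor K (tensor K X D) W s w))"
      if s: "s \<in> carrier (tensor K X D)" for s
      by (rule tensor_linear_eqI[OF X D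
            linear_map_compose[OF tensor_map_linear[OF iX u] E]
            linear_map_compose[OF linear_map_compose[OF pure_tensor_linear(2)[OF XD W w]
              tensor_assoc_linear[OF X D W]] tensor_map_linear[OF iX U]] _ s])
        (simp add: w tensor_assoc_pure X D W tensor_map_pure[OF iX e] tensor_map_pure[OF iX u]
          tensor_map_pure[OF iX U] expand_left_pure[OF u Y C] linear_mapD(3)[OF u])
    show "expand_left K B X Y q (tensor K C W) (expand_left K A B C p W (pure_tensor K A W a w))
      = tensor_map K X (tensor K D W) X (tensor K Y (tensor K C W)) id (expand_left K D Y C u W)
          (expand_left K A X D r W (pure_tensor K A W a w))"
      using a w by (simp add: expand_left_pure[OF p B C W] expand_left_pure[OF r X D W]
          2 linear_mapD(3)[OF p] 3[symmetric] linear_mapD(3)[OF r] eq)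
  qed
qed

lemma expand_right_expand_right:
  assumes p: "linear_map K A (tensor K C B) p" and q: "linear_map K B (tensor K Y X) q"
    and r: "linear_map K A (tensor K D X) r" and u: "linear_map K D (tensor K C Y) u"
    and C: "vectorspace K C" and X: "vectorspace K X" and Y: "vectorspace K Y"
    and W: "vectorspace K W"
    and eq: "\<And>a. a \<in> carrier A \<Longrightarrow>
      expand_right K B Y X q C (p a) = tensor_map K D X (tensor K C Y) X u id (r a)"
    and t: "t \<in> carrier (tensor K W A)"
  shows "expand_right K B Y X q (tensor K W C) (expand_right K A C B p W t)
    = tensor_map K (tensor K W D) X (tensor K (tensor K W C) Y) X (expand_right K D C Y u W) id
        (expand_right K A D X r W t)"
proof -
  note A = linear_mapD(1)[OF p] and B = linear_mapD(1)[OF q] and D = linear_mapD(1)[OF u]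
  note WC = tensor_vectorspace[OF W C] and CY = tensor_vectorspace[OF C Y]
    and YX = tensor_vectorspace[OF Y X] and CB = tensor_vectorspace[OF C B]
    and DX = tensor_vectorspace[OF D X]
  note iX = linear_map_ident(2)[OF X]
  note U = expand_right_linear[OF u C Y W] and Q = expand_right_linear[OF q Y X WC]
    and Q' = expand_right_linear[OF q Y X C]
  show ?thesis
  proof (rule tensor_linear_eqI[OF W A _ _ _ t])
    show "linear_map K (tensor K W A) (tensor K (tensor K (tensor K W C) Y) X)
        (\<lambda>t. expand_right K B Y X q (tensor K W C) (expand_right K A C B p W t))"
      by (rule linear_map_compose[OF expand_right_linear[OF p C B W] Q])
    show "linear_map K (tensor K W A) (tensor K (tensor K (tensor K W C) Y) X)
        (\<lambda>t. tensor_map K (tensor K W D) X (tensor K (tensor K W C) Y) X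
          (expand_right K D C Y u W) id (expand_right K A D X r W t))"
      by (rule linear_map_compose[OF expand_right_linear[OF r D X W] tensor_map_linear[OF U iX]])
    fix w a assume w: "w \<in> carrier W" and a: "a \<in> carrier A"
    let ?e = "\<lambda>z. tensor_assoc_inv K W C Y (pure_tensor K W (tensor K C Y) w z)"
    let ?E = "tensor_map K (tensor K C Y) X (tensor K (tensor K W C) Y) X ?e id"
    have e: "linear_map K (tensor K C Y) (tensor K (tensor K W C) Y) ?e"
      by (rule linear_map_compose[OF pure_tensor_linear(1)[OF W CY w]
            tensor_assoc_inv_linear[OF W C Y]])
    note E = tensor_map_linear[OF e iX]
    have 1: "?E (tensor_assoc_inv K C Y X (pure_tensor K C (tensor K Y X) c s))
        = tensor_assoc_inv K (tensor K W C) Y X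
            (pure_tensor K (tensor K W C) (tensor K Y X) (pure_tensor K W C w c) s)"
      if c: "c \<in> carrier C" and s: "s \<in> carrier (tensor K Y X)" for s c
    proof -
      have wc: "pure_tensor K W C w c \<in> carrier (tensor K W C)"
        using c w C W by simp
      show ?thesis
        by (rule tensor_linear_eqI[OF Y X
              linear_map_compose[OF linear_map_compose[OF pure_tensor_linear(1)[OF C YX c]
                tensor_assoc_inv_linear[OF C Y X]] E]
              linear_map_compose[OF pure_tensor_linear(1)[OF WC YX wc]
                tensor_assoc_inv_linear[OF WC Y X]] _ s])
          (simp add: c w C W X Y WC tensor_assoc_inv_pure tensor_map_pure[OF e iX])
    qed
    have 2: "expand_right K B Y X q (tensor K W C)
          (tensor_assoc_inv K W C B (pure_tensor K W (tensor K C B) w s))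
        = ?E (expand_right K B Y X q C s)" if s: "s \<in> carrier (tensor K C B)" for s
      by (rule tensor_linear_eqI[OF C B
            linear_map_compose[OF linear_map_compose[OF pure_tensor_linear(1)[OF W CB w]
              tensor_assoc_inv_linear[OF W C B]] Q] linear_map_compose[OF Q' E] _ s])
        (simp add: w tensor_assoc_inv_pure B C W WC expand_right_pure[OF q Y X] 1
          linear_mapD(3)[OF q])
    have 3: "?E (tensor_map K D X (tensor K C Y) X u id s)
        = tensor_map K (tensor K W D) X (tensor K (tensor K W C) Y) X (expand_right K D C Y u W) id
            (tensor_assoc_inv K W D X (pure_tensor K W (tensor K D X) w s))"
      if s: "s \<in> carrier (tensor K D X)" for s
      by (rule tensor_linear_eqI[OF D X
            linear_map_compose[OF tensor_map_linear[OF u iX] E]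
            linear_map_compose[OF linear_map_compose[OF pure_tensor_linear(1)[OF W DX w]
              tensor_assoc_inv_linear[OF W D X]] tensor_map_linear[OF U iX]] _ s])
        (simp add: w tensor_assoc_inv_pure X D W tensor_map_pure[OF e iX] tensor_map_pure[OF u iX]
          tensor_map_pure[OF U iX] expand_right_pure[OF u C Y] linear_mapD(3)[OF u])
    show "expand_right K B Y X q (tensor K W C) (expand_right K A C B p W (pure_tensor K W A w a))
      = tensor_map K (tensor K W D) X (tensor K (tensor K W C) Y) X (expand_right K D C Y u W) id
          (expand_right K A D X r W (pure_tensor K W A w a))"
      using a w by (simp add: expand_right_pure[OF p C B W] expand_right_pure[OF r D X W]
          2 linear_mapD(3)[OF p] 3[symmetric] linear_mapD(3)[OF r] eq)
  qed
qed

section \<open>Counits\<close>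

lemma linear_functional_closed:
  assumes "linear_map K C (base_space K) \<epsilon>" "c \<in> carrier C"
  shows "\<epsilon> c \<in> carrier K"
  using linear_mapD(3)[OF assms] by (simp add: base_space_def)

lemma
  assumes \<epsilon>: "linear_map K C (base_space K) \<epsilon>" and V: "vectorspace K V"
  shows counit_left_linear: "linear_map K (tensor K C V) V (counit_left K C V \<epsilon>)"
    and counit_left_pure: "\<And>c v. c \<in> carrier C \<Longrightarrow> v \<in> carrier V \<Longrightarrow>
      counit_left K C V \<epsilon> (pure_tensor K C V c v) = \<epsilon> c \<odot>\<^bsub>V\<^esub> v"
    and counit_right_linear: "linear_map K (tensor K V C) V (counit_right K V C \<epsilon>)"
    and counit_right_pure: "\<And>c v. c \<in> carrier C \<Longrightarrow> v \<in> carrier V \<Longrightarrow>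
      counit_right K V C \<epsilon> (pure_tensor K V C v c) = \<epsilon> c \<odot>\<^bsub>V\<^esub> v"
proof -
  interpret V: vectorspace K V by (rule V)
  note C = linear_mapD(1)[OF \<epsilon>]
  have e: "\<And>c. c \<in> carrier C \<Longrightarrow> \<epsilon> c \<in> carrier K"
    "\<And>c c'. c \<in> carrier C \<Longrightarrow> c' \<in> carrier C \<Longrightarrow> \<epsilon> (c \<oplus>\<^bsub>C\<^esub> c') = \<epsilon> c \<oplus>\<^bsub>K\<^esub> \<epsilon> c'"
    "\<And>k c. k \<in> carrier K \<Longrightarrow> c \<in> carrier C \<Longrightarrow> \<epsilon> (k \<odot>\<^bsub>C\<^esub> c) = k \<otimes>\<^bsub>K\<^esub> \<epsilon> c"
    using linear_mapD(3-5)[OF \<epsilon>] by (simp_all add: base_space_def)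
  have comm: "\<epsilon> c \<odot>\<^bsub>V\<^esub> (k \<odot>\<^bsub>V\<^esub> v) = k \<odot>\<^bsub>V\<^esub> (\<epsilon> c \<odot>\<^bsub>V\<^esub> v)"
    if "c \<in> carrier C" "v \<in> carrier V" "k \<in> carrier K" for c v k
    using that e(1) by (simp add: V.smult_assoc1[symmetric] V.R.m_comm)
  have "bilinear_map K C V V (\<lambda>c v. \<epsilon> c \<odot>\<^bsub>V\<^esub> v)"
    by (rule bilinear_mapI[OF C V V])
      (simp_all add: e comm V.smult_l_distr V.smult_r_distr V.smult_assoc1)
  note l = tensor_lift_linear_pure[OF C V this V]
  have "bilinear_map K V C V (\<lambda>v c. \<epsilon> c \<odot>\<^bsub>V\<^esub> v)"
    by (rule bilinear_mapI[OF V C V])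
      (simp_all add: e comm V.smult_l_distr V.smult_r_distr V.smult_assoc1)
  note r = tensor_lift_linear_pure[OF V C this V]
  show "linear_map K (tensor K C V) V (counit_left K C V \<epsilon>)"
    "\<And>c v. c \<in> carrier C \<Longrightarrow> v \<in> carrier V \<Longrightarrow>
      counit_left K C V \<epsilon> (pure_tensor K C V c v) = \<epsilon> c \<odot>\<^bsub>V\<^esub> v"
    "linear_map K (tensor K V C) V (counit_right K V C \<epsilon>)"
    "\<And>c v. c \<in> carrier C \<Longrightarrow> v \<in> carrier V \<Longrightarrow>
      counit_right K V C \<epsilon> (pure_tensor K V C v c) = \<epsilon> c \<odot>\<^bsub>V\<^esub> v"
    using l r by (simp_all add: counit_left_def counit_right_def)
qed

lemma counit_left_natural:
  assumes \<epsilon>: "linear_map K C (base_space K) \<epsilon>" and h: "linear_map K V W h"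
    and t: "t \<in> carrier (tensor K C V)"
  shows "counit_left K C W \<epsilon> (tensor_map K C V C W id h t) = h (counit_left K C V \<epsilon> t)"
proof -
  note C = linear_mapD(1)[OF \<epsilon>] and V = linear_mapD(1,2)[OF h]
  note iC = linear_map_ident(2)[OF C]
  show ?thesis
    by (rule tensor_linear_eqI[OF C V(1)
          linear_map_compose[OF tensor_map_linear[OF iC h] counit_left_linear[OF \<epsilon> V(2)]]
          linear_map_compose[OF counit_left_linear[OF \<epsilon> V(1)] h] _ t])
      (simp add: tensor_map_pure[OF iC h] counit_left_pure[OF \<epsilon>] V linear_functional_closed[OF \<epsilon>] linear_mapD(3,5)[OF h])
qed

lemma counit_right_natural:
  assumes \<epsilon>: "linear_map K C (base_space K) \<epsilon>" and h: "linear_map K V W h"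
    and t: "t \<in> carrier (tensor K V C)"
  shows "counit_right K W C \<epsilon> (tensor_map K V C W C h id t) = h (counit_right K V C \<epsilon> t)"
proof -
  note C = linear_mapD(1)[OF \<epsilon>] and V = linear_mapD(1,2)[OF h]
  note iC = linear_map_ident(2)[OF C]
  show ?thesis
    by (rule tensor_linear_eqI[OF V(1) C
          linear_map_compose[OF tensor_map_linear[OF h iC] counit_right_linear[OF \<epsilon> V(2)]]
          linear_map_compose[OF counit_right_linear[OF \<epsilon> V(1)] h] _ t])
      (simp add: tensor_map_pure[OF h iC] counit_right_pure[OF \<epsilon>] V linear_functional_closed[OF \<epsilon>] linear_mapD(3,5)[OF h])
qed

text \<open>
  Coassociativity appears in two forms, one for each side; the second arises from the first by applying
  the inverse associator.
\<close>

lemma coalgebraD: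
  assumes "coalgebra K C \<Delta> \<epsilon>"
  shows "linear_map K C (tensor K C C) \<Delta>" "linear_map K C (base_space K) \<epsilon>" "vectorspace K C"
    and "\<And>c. c \<in> carrier C \<Longrightarrow>
           expand_left K C C C \<Delta> C (\<Delta> c) = tensor_map K C C C (tensor K C C) id \<Delta> (\<Delta> c)"
    and "\<And>c. c \<in> carrier C \<Longrightarrow>
           expand_right K C C C \<Delta> C (\<Delta> c) = tensor_map K C C (tensor K C C) C \<Delta> id (\<Delta> c)"
    and "\<And>c. c \<in> carrier C \<Longrightarrow> counit_left K C C \<epsilon> (\<Delta> c) = c"
    and "\<And>c. c \<in> carrier C \<Longrightarrow> counit_right K C C \<epsilon> (\<Delta> c) = c"
proof -
  show \<Delta>: "linear_map K C (tensor K C C) \<Delta>" and "linear_map K C (base_space K) \<epsilon>"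
    and coassoc: "\<And>c. c \<in> carrier C \<Longrightarrow>
           expand_left K C C C \<Delta> C (\<Delta> c) = tensor_map K C C C (tensor K C C) id \<Delta> (\<Delta> c)"
    and "\<And>c. c \<in> carrier C \<Longrightarrow> counit_left K C C \<epsilon> (\<Delta> c) = c"
    and "\<And>c. c \<in> carrier C \<Longrightarrow> counit_right K C C \<epsilon> (\<Delta> c) = c"
    using assms by (simp_all add: coalgebra_def expand_left_def)
  show C: "vectorspace K C" by (rule linear_mapD(1)[OF \<Delta>])
  fix c assume c: "c \<in> carrier C"
  have "tensor_map K C C (tensor K C C) C \<Delta> id (\<Delta> c) \<in> carrier (tensor K (tensor K C C) C)"
    using linear_mapD(3)[OF tensor_map_linear[OF \<Delta> linear_map_ident(2)[OF C]]]
      linear_mapD(3)[OF \<Delta> c] .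
  then show "expand_right K C C C \<Delta> C (\<Delta> c) = tensor_map K C C (tensor K C C) C \<Delta> id (\<Delta> c)"
    using tensor_assoc_inverse(2)[OF C C C] coassoc[OF c]
    unfolding expand_right_def expand_left_def by metis
qed

text \<open>
  The counit law for the cofree coaction is that of \<open>A\<close>, because \<open>\<epsilon> \<otimes> id\<close> leaves the appended factor \<open>v\<close>
  alone.
\<close>

lemma counit_left_expand_left:
  assumes coalg: "coalgebra K A \<Delta> \<epsilon>" and V: "vectorspace K V" and t: "t \<in> carrier (tensor K A V)"
  shows "counit_left K A (tensor K A V) \<epsilon> (expand_left K A A A \<Delta> V t) = t"
proof -
  note \<Delta> = coalgebraD(1)[OF coalg] and \<epsilon> = coalgebraD(2)[OF coalg] and A = coalgebraD(3)[OF coalg]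
  note AV = tensor_vectorspace[OF A V] and AA = tensor_vectorspace[OF A A]
  have key: "counit_left K A (tensor K A V) \<epsilon>
        (tensor_assoc K A A V (pure_tensor K (tensor K A A) V s v))
      = pure_tensor K A V (counit_left K A A \<epsilon> s) v"
    if s: "s \<in> carrier (tensor K A A)" and v: "v \<in> carrier V" for s v
    by (rule tensor_linear_eqI[OF A A
          linear_map_compose[OF linear_map_compose[OF pure_tensor_linear(2)[OF AA V v]
            tensor_assoc_linear[OF A A V]] counit_left_linear[OF \<epsilon> AV]]
          linear_map_compose[OF counit_left_linear[OF \<epsilon> A] pure_tensor_linear(2)[OF A V v]] _ s])
      (simp add: v A V AV tensor_assoc_pure counit_left_pure[OF \<epsilon>] linear_functional_closed[OF \<epsilon>]
        linear_mapD(5)[OF pure_tensor_linear(2)[OF A V v]])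
  show ?thesis
    by (rule tensor_linear_eqI[OF A V
          linear_map_compose[OF expand_left_linear[OF \<Delta> A A V] counit_left_linear[OF \<epsilon> AV]]
          linear_map_ident(1)[OF AV] _ t])
      (simp add: expand_left_pure[OF \<Delta> A A V] key linear_mapD(3)[OF \<Delta>] coalgebraD(6)[OF coalg])
qed

lemma counit_right_expand_right:
  assumes coalg: "coalgebra K A \<Delta> \<epsilon>" and V: "vectorspace K V" and t: "t \<in> carrier (tensor K V A)"
  shows "counit_right K (tensor K V A) A \<epsilon> (expand_right K A A A \<Delta> V t) = t"
proof -
  note \<Delta> = coalgebraD(1)[OF coalg] and \<epsilon> = coalgebraD(2)[OF coalg] and A = coalgebraD(3)[OF coalg]
  note VA = tensor_vectorspace[OF V A] and AA = tensor_vectorspace[OF A A]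
  have key: "counit_right K (tensor K V A) A \<epsilon>
        (tensor_assoc_inv K V A A (pure_tensor K V (tensor K A A) v s))
      = pure_tensor K V A v (counit_right K A A \<epsilon> s)"
    if s: "s \<in> carrier (tensor K A A)" and v: "v \<in> carrier V" for s v
    by (rule tensor_linear_eqI[OF A A
          linear_map_compose[OF linear_map_compose[OF pure_tensor_linear(1)[OF V AA v]
            tensor_assoc_inv_linear[OF V A A]] counit_right_linear[OF \<epsilon> VA]]
          linear_map_compose[OF counit_right_linear[OF \<epsilon> A] pure_tensor_linear(1)[OF V A v]] _ s])
      (simp add: v A V VA tensor_assoc_inv_pure counit_right_pure[OF \<epsilon>] linear_functional_closed[OF \<epsilon>]
        linear_mapD(5)[OF pure_tensor_linear(1)[OF V A v]])
  show ?thesis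
    by (rule tensor_linear_eqI[OF V A
          linear_map_compose[OF expand_right_linear[OF \<Delta> A A V] counit_right_linear[OF \<epsilon> VA]]
          linear_map_ident(1)[OF VA] _ t])
      (simp add: expand_right_pure[OF \<Delta> A A V] key linear_mapD(3)[OF \<Delta>] coalgebraD(7)[OF coalg])
qed

section \<open>Equalizers in cofree corepresentations\<close>

text \<open>
  A subspace cut out of the cofree corepresentation \<open>A \<otimes> V\<close> as an equalizer is a subcorepresentation as
  soon as its cofree coaction is again equalized. The coaction is \<open>\<psi> = P D\<close> with the retraction \<open>P\<close>
  above. The laws for \<open>\<psi>\<close> are verified after applying the injections \<open>A \<otimes> E \<rightarrow> A \<otimes> (A \<otimes> V)\<close> and
  \<open>A \<otimes> (A \<otimes> E) \<rightarrow> A \<otimes> (A \<otimes> (A \<otimes> V))\<close>, where they become the laws for \<open>D\<close>.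
\<close>

lemma equalizer_defines_left_corep:
  assumes coalg: "coalgebra K A \<Delta> \<epsilon>" and V: "vectorspace K V"
    and f: "linear_map K (tensor K A V) X f" and g: "linear_map K (tensor K A V) X g"
    and inv: "\<And>F. F \<in> carrier (tensor K A V) \<Longrightarrow> f F = g F \<Longrightarrow>
      tensor_map K A (tensor K A V) A X id f (expand_left K A A A \<Delta> V F)
        = tensor_map K A (tensor K A V) A X id g (expand_left K A A A \<Delta> V F)"
  shows "defines_left_corep K A \<Delta> \<epsilon> V (equalizer (tensor K A V) f g)"
proof -
  let ?W = "tensor K A V"
  let ?E = "equalizer ?W f g"
  let ?D = "expand_left K A A A \<Delta> V"
  let ?i = "tensor_map K A ?E A ?W id id"
  note \<Delta> = coalgebraD(1)[OF coalg] and \<epsilon> = coalgebraD(2)[OF coalg] and A = coalgebraD(3)[OF coalg]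
  note W = tensor_vectorspace[OF A V] and E = equalizer_vectorspace[OF f g]
  note AE = tensor_vectorspace[OF A E] and AW = tensor_vectorspace[OF A W]
  note iA = linear_map_ident(2)[OF A] and iE = equalizer_inclusion[OF f g]
  note D = expand_left_linear[OF \<Delta> A A V] and i = tensor_map_linear[OF iA iE]
  obtain P where P: "linear_map K (tensor K A ?W) (tensor K A ?E) P"
    and Pi: "\<And>t. t \<in> carrier (tensor K A ?E) \<Longrightarrow> P (?i t) = t"
    and iP: "\<And>t. t \<in> carrier (tensor K A ?W) \<Longrightarrow>
      tensor_map K A ?W A X id f t = tensor_map K A ?W A X id g t \<Longrightarrow> ?i (P t) = t"
    by (rule tensor_equalizer_retraction_left[OF A f g]) (rule that)
  define \<psi> where "\<psi> = restrict (\<lambda>F. P (?D F)) (carrier ?E)"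
  have EW: "F \<in> carrier ?W" if "F \<in> carrier ?E" for F
    using that by simp
  have \<psi>: "linear_map K ?E (tensor K A ?E) \<psi>"
    by (rule linear_map_cong[OF linear_map_compose[OF linear_map_compose[OF iE D] P]])
      (simp add: \<psi>_def)
  have i\<psi>: "?i (\<psi> F) = ?D F" if F: "F \<in> carrier ?E" for F
    using iP[OF linear_mapD(3)[OF D]] inv[of F] F by (simp add: \<psi>_def)
  have counit: "counit_left K A ?E \<epsilon> (\<psi> F) = F" if F: "F \<in> carrier ?E" for F
    using counit_left_natural[OF \<epsilon> iE linear_mapD(3)[OF \<psi> F]]
      counit_left_expand_left[OF coalg V EW[OF F]]
    by (simp add: i\<psi>[OF F])
  have coassoc: "expand_left K A A A \<Delta> ?E (\<psi> F) = tensor_map K A ?E A (tensor K A ?E) id \<psi> (\<psi> F)"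
    if F: "F \<in> carrier ?E" for F
  proof -
    let ?x = "expand_left K A A A \<Delta> ?E (\<psi> F)"
      and ?y = "tensor_map K A ?E A (tensor K A ?E) id \<psi> (\<psi> F)"
    let ?j = "tensor_map K A (tensor K A ?E) A (tensor K A ?W) id ?i"
      and ?Q = "tensor_map K A (tensor K A ?W) A (tensor K A ?E) id P"
    have \<psi>F: "\<psi> F \<in> carrier (tensor K A ?E)" by (rule linear_mapD(3)[OF \<psi> F])
    have x: "?x \<in> carrier (tensor K A (tensor K A ?E))"
      by (rule linear_mapD(3)[OF expand_left_linear[OF \<Delta> A A E] \<psi>F])
    have y: "?y \<in> carrier (tensor K A (tensor K A ?E))"
      by (rule linear_mapD(3)[OF tensor_map_linear[OF iA \<psi>] \<psi>F])
    \<comment> \<open>\<open>?j\<close> is the inclusion of threefold tensors, with left inverse \<open>?Q\<close>.\<close>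
    have inj: "?Q (?j t) = t" if "t \<in> carrier (tensor K A (tensor K A ?E))" for t
      unfolding tensor_map_compose[OF iA i iA P that]
      by (rule tensor_map_ident[OF A AE _ _ that]) (simp_all add: Pi)
    have "?j ?x = expand_left K A A A \<Delta> ?W (?D F)"
      using expand_left_natural[OF \<Delta> A A iE \<psi>F] i\<psi>[OF F] by simp
    also have "\<dots> = tensor_map K A ?W A (tensor K A ?W) id ?D (?D F)"
      by (rule expand_left_expand_left[OF \<Delta> \<Delta> \<Delta> \<Delta> A A A V coalgebraD(4)[OF coalg] EW[OF F]])
    also have "\<dots> = tensor_map K A ?W A (tensor K A ?W) id ?D (?i (\<psi> F))"
      by (simp add: i\<psi>[OF F])
    also have "\<dots> = tensor_map K A ?E A (tensor K A ?W) (\<lambda>a. id (id a)) (\<lambda>x. ?D (id x)) (\<psi> F)"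
      by (rule tensor_map_compose[OF iA iE iA D \<psi>F])
    also have "\<dots> = tensor_map K A ?E A (tensor K A ?W) (\<lambda>a. id (id a)) (\<lambda>x. ?i (\<psi> x)) (\<psi> F)"
      by (rule tensor_map_cong[OF linear_map_compose[OF iA iA] linear_map_compose[OF iE D] _ _ \<psi>F])
        (use i\<psi> in auto)
    also have "\<dots> = ?j ?y"
      by (rule tensor_map_compose[OF iA \<psi> iA i \<psi>F, symmetric])
    finally show ?thesis using inj[OF x] inj[OF y] by metis
  qed
  have ext: "\<psi> \<in> extensional (carrier ?E)" by (simp add: \<psi>_def)
  show ?thesis
    unfolding defines_left_corep_def
  proof (rule ex1I[of _ \<psi>])
    show "\<psi> \<in> extensional (carrier ?E) \<and> left_corep K A \<Delta> \<epsilon> ?E \<psi> \<and>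
      (\<forall>F\<in>carrier ?E. ?i (\<psi> F) = tensor_assoc K A A V (tensor_map K A V (tensor K A A) V \<Delta> id F))"
      unfolding left_corep_def
      using ext \<psi> counit coassoc i\<psi> unfolding expand_left_def by blast
  next
    fix \<phi> assume \<phi>: "\<phi> \<in> extensional (carrier ?E) \<and> left_corep K A \<Delta> \<epsilon> ?E \<phi> \<and>
      (\<forall>F\<in>carrier ?E. ?i (\<phi> F) = tensor_assoc K A A V (tensor_map K A V (tensor K A A) V \<Delta> id F))"
    then have lin: "linear_map K ?E (tensor K A ?E) \<phi>" by (simp add: left_corep_def)
    show "\<phi> = \<psi>"
    proof (rule extensionalityI[of _ "carrier ?E"])
      fix F assume F: "F \<in> carrier ?E"
      have "?i (\<phi> F) = ?i (\<psi> F)" using \<phi> F i\<psi>[OF F] by (simp add: expand_left_def)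
      then show "\<phi> F = \<psi> F"
        using Pi[OF linear_mapD(3)[OF lin F]] Pi[OF linear_mapD(3)[OF \<psi> F]] by metis
    qed (use \<phi> ext in simp_all)
  qed
qed

lemma tensor_assoc_expand_right:
  assumes f: "linear_map K A (tensor K X Y) f" and X: "vectorspace K X" and Y: "vectorspace K Y"
    and W: "vectorspace K W" and t: "t \<in> carrier (tensor K W A)"
  shows "tensor_assoc K W X Y (expand_right K A X Y f W t) = tensor_map K W A W (tensor K X Y) id f t"
  unfolding expand_right_def
  by (rule tensor_assoc_inverse(1)[OF W X Y])
    (rule linear_mapD(3)[OF tensor_map_linear[OF linear_map_ident(2)[OF W] f] t])

lemma equalizer_defines_right_corep:
  assumes coalg: "coalgebra K A \<Delta> \<epsilon>" and V: "vectorspace K V"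
    and f: "linear_map K (tensor K V A) X f" and g: "linear_map K (tensor K V A) X g"
    and inv: "\<And>F. F \<in> carrier (tensor K V A) \<Longrightarrow> f F = g F \<Longrightarrow>
      tensor_map K (tensor K V A) A X A f id (expand_right K A A A \<Delta> V F)
        = tensor_map K (tensor K V A) A X A g id (expand_right K A A A \<Delta> V F)"
  shows "defines_right_corep K A \<Delta> \<epsilon> V (equalizer (tensor K V A) f g)"
proof -
  let ?W = "tensor K V A"
  let ?E = "equalizer ?W f g"
  let ?D = "expand_right K A A A \<Delta> V"
  let ?i = "tensor_map K ?E A ?W A id id"
  note \<Delta> = coalgebraD(1)[OF coalg] and \<epsilon> = coalgebraD(2)[OF coalg] and A = coalgebraD(3)[OF coalg]
  note W = tensor_vectorspace[OF V A] and E = equalizer_vectorspace[OF f g]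
  note EA = tensor_vectorspace[OF E A] and WA = tensor_vectorspace[OF W A]
  note iA = linear_map_ident(2)[OF A] and iE = equalizer_inclusion[OF f g]
  note D = expand_right_linear[OF \<Delta> A A V] and i = tensor_map_linear[OF iE iA]
  obtain P where P: "linear_map K (tensor K ?W A) (tensor K ?E A) P"
    and Pi: "\<And>t. t \<in> carrier (tensor K ?E A) \<Longrightarrow> P (?i t) = t"
    and iP: "\<And>t. t \<in> carrier (tensor K ?W A) \<Longrightarrow>
      tensor_map K ?W A X A f id t = tensor_map K ?W A X A g id t \<Longrightarrow> ?i (P t) = t"
    by (rule tensor_equalizer_retraction_right[OF A f g]) (rule that)
  define \<psi> where "\<psi> = restrict (\<lambda>F. P (?D F)) (carrier ?E)"
  have EW: "F \<in> carrier ?W" if "F \<in> carrier ?E" for F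
    using that by simp
  have \<psi>: "linear_map K ?E (tensor K ?E A) \<psi>"
    by (rule linear_map_cong[OF linear_map_compose[OF linear_map_compose[OF iE D] P]])
      (simp add: \<psi>_def)
  have i\<psi>: "?i (\<psi> F) = ?D F" if F: "F \<in> carrier ?E" for F
    using iP[OF linear_mapD(3)[OF D]] inv[of F] F by (simp add: \<psi>_def)
  have counit: "counit_right K ?E A \<epsilon> (\<psi> F) = F" if F: "F \<in> carrier ?E" for F
    using counit_right_natural[OF \<epsilon> iE linear_mapD(3)[OF \<psi> F]]
      counit_right_expand_right[OF coalg V EW[OF F]]
    by (simp add: i\<psi>[OF F])
  have coassoc: "expand_right K A A A \<Delta> ?E (\<psi> F) = tensor_map K ?E A (tensor K ?E A) A \<psi> id (\<psi> F)"
    if F: "F \<in> carrier ?E" for F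
  proof -
    let ?x = "expand_right K A A A \<Delta> ?E (\<psi> F)"
      and ?y = "tensor_map K ?E A (tensor K ?E A) A \<psi> id (\<psi> F)"
    let ?j = "tensor_map K (tensor K ?E A) A (tensor K ?W A) A ?i id"
      and ?Q = "tensor_map K (tensor K ?W A) A (tensor K ?E A) A P id"
    have \<psi>F: "\<psi> F \<in> carrier (tensor K ?E A)" by (rule linear_mapD(3)[OF \<psi> F])
    have x: "?x \<in> carrier (tensor K (tensor K ?E A) A)"
      by (rule linear_mapD(3)[OF expand_right_linear[OF \<Delta> A A E] \<psi>F])
    have y: "?y \<in> carrier (tensor K (tensor K ?E A) A)"
      by (rule linear_mapD(3)[OF tensor_map_linear[OF \<psi> iA] \<psi>F])
    \<comment> \<open>\<open>?j\<close> is the inclusion of threefold tensors, with left inverse \<open>?Q\<close>.\<close>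
    have inj: "?Q (?j t) = t" if "t \<in> carrier (tensor K (tensor K ?E A) A)" for t
      unfolding tensor_map_compose[OF i iA P iA that]
      by (rule tensor_map_ident[OF EA A _ _ that]) (simp_all add: Pi)
    have "?j ?x = expand_right K A A A \<Delta> ?W (?D F)"
      using expand_right_natural[OF \<Delta> A A iE \<psi>F] i\<psi>[OF F] by simp
    also have "\<dots> = tensor_map K ?W A (tensor K ?W A) A ?D id (?D F)"
      by (rule expand_right_expand_right[OF \<Delta> \<Delta> \<Delta> \<Delta> A A A V coalgebraD(5)[OF coalg] EW[OF F]])
    also have "\<dots> = tensor_map K ?W A (tensor K ?W A) A ?D id (?i (\<psi> F))"
      by (simp add: i\<psi>[OF F])
    also have "\<dots> = tensor_map K ?E A (tensor K ?W A) A (\<lambda>x. ?D (id x)) (\<lambda>a. id (id a)) (\<psi> F)"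
      by (rule tensor_map_compose[OF iE iA D iA \<psi>F])
    also have "\<dots> = tensor_map K ?E A (tensor K ?W A) A (\<lambda>x. ?i (\<psi> x)) (\<lambda>a. id (id a)) (\<psi> F)"
      by (rule tensor_map_cong[OF linear_map_compose[OF iE D] linear_map_compose[OF iA iA] _ _ \<psi>F])
        (use i\<psi> in auto)
    also have "\<dots> = ?j ?y"
      by (rule tensor_map_compose[OF \<psi> iA i iA \<psi>F, symmetric])
    finally show ?thesis using inj[OF x] inj[OF y] by metis
  qed
  have ext: "\<psi> \<in> extensional (carrier ?E)" by (simp add: \<psi>_def)
  have assoc_i\<psi>: "tensor_assoc K V A A (?i (\<psi> F)) = tensor_map K V A V (tensor K A A) id \<Delta> F"
    if F: "F \<in> carrier ?E" for F
    unfolding i\<psi>[OF F] by (rule tensor_assoc_expand_right[OF \<Delta> A A V EW[OF F]])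
  have coassoc': "tensor_map K ?E A ?E (tensor K A A) id \<Delta> (\<psi> F)
      = tensor_assoc K ?E A A (tensor_map K ?E A (tensor K ?E A) A \<psi> id (\<psi> F))"
    if F: "F \<in> carrier ?E" for F
    unfolding coassoc[OF F, symmetric]
    by (rule tensor_assoc_expand_right[OF \<Delta> A A E linear_mapD(3)[OF \<psi> F], symmetric])
  show ?thesis
    unfolding defines_right_corep_def
  proof (rule ex1I[of _ \<psi>])
    show "\<psi> \<in> extensional (carrier ?E) \<and> right_corep K A \<Delta> \<epsilon> ?E \<psi> \<and>
      (\<forall>F\<in>carrier ?E. tensor_assoc K V A A (?i (\<psi> F)) = tensor_map K V A V (tensor K A A) id \<Delta> F)"
      unfolding right_corep_def
      using ext \<psi> counit coassoc' assoc_i\<psi> by blast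
  next
    fix \<phi> assume \<phi>: "\<phi> \<in> extensional (carrier ?E) \<and> right_corep K A \<Delta> \<epsilon> ?E \<phi> \<and>
      (\<forall>F\<in>carrier ?E. tensor_assoc K V A A (?i (\<phi> F)) = tensor_map K V A V (tensor K A A) id \<Delta> F)"
    then have lin: "linear_map K ?E (tensor K ?E A) \<phi>" by (simp add: right_corep_def)
    show "\<phi> = \<psi>"
    proof (rule extensionalityI[of _ "carrier ?E"])
      fix F assume F: "F \<in> carrier ?E"
      have "?i (\<phi> F) = tensor_assoc_inv K V A A (tensor_assoc K V A A (?i (\<phi> F)))"
        by (rule tensor_assoc_inverse(2)[OF V A A, symmetric])
          (rule linear_mapD(3)[OF i linear_mapD(3)[OF lin F]])
      also have "\<dots> = ?i (\<psi> F)" using \<phi> F i\<psi>[OF F] by (simp add: expand_right_def)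
      finally show "\<phi> F = \<psi> F"
        using Pi[OF linear_mapD(3)[OF lin F]] Pi[OF linear_mapD(3)[OF \<psi> F]] by metis
    qed (use \<phi> ext in simp_all)
  qed
qed

section \<open>Induced corepresentations\<close>

lemma
  assumes \<Delta>: "linear_map K A (tensor K A A) \<Delta>" and \<pi>: "linear_map K A C \<pi>"
  shows coact_R_linear: "linear_map K A (tensor K A C) (coact_R K A \<Delta> C \<pi>)"
    and coact_L_linear: "linear_map K A (tensor K C A) (coact_L K A \<Delta> C \<pi>)"
proof -
  note iA = linear_map_ident(2)[OF linear_mapD(1)[OF \<Delta>]]
  show "linear_map K A (tensor K A C) (coact_R K A \<Delta> C \<pi>)"
    using linear_map_compose[OF \<Delta> tensor_map_linear[OF iA \<pi>]] by (simp add: coact_R_def[abs_def])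
  show "linear_map K A (tensor K C A) (coact_L K A \<Delta> C \<pi>)"
    using linear_map_compose[OF \<Delta> tensor_map_linear[OF \<pi> iA]] by (simp add: coact_L_def[abs_def])
qed

text \<open>
  Move \<open>\<pi>\<close> out by naturality, apply coassociativity of \<open>\<Delta>\<close>, and absorb \<open>\<pi>\<close> into the second leg.
\<close>

lemma coact_R_coassoc:
  assumes coalg: "coalgebra K A \<Delta> \<epsilon>" and \<pi>: "linear_map K A C \<pi>" and a: "a \<in> carrier A"
  shows "expand_left K A A A \<Delta> C (coact_R K A \<Delta> C \<pi> a)
    = tensor_map K A A A (tensor K A C) id (coact_R K A \<Delta> C \<pi>) (\<Delta> a)"
proof -
  note \<Delta> = coalgebraD(1)[OF coalg] and A = coalgebraD(3)[OF coalg]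
  note iA = linear_map_ident(2)[OF A] and \<Delta>a = linear_mapD(3)[OF \<Delta> a]
  note A\<pi> = tensor_map_linear[OF iA \<pi>]
  have "expand_left K A A A \<Delta> C (coact_R K A \<Delta> C \<pi> a)
      = tensor_map K A (tensor K A A) A (tensor K A C) id (tensor_map K A A A C id \<pi>)
          (expand_left K A A A \<Delta> A (\<Delta> a))"
    unfolding coact_R_def by (rule expand_left_natural[OF \<Delta> A A \<pi> \<Delta>a, symmetric])
  also have "\<dots> = tensor_map K A (tensor K A A) A (tensor K A C) id (tensor_map K A A A C id \<pi>)
          (tensor_map K A A A (tensor K A A) id \<Delta> (\<Delta> a))"
    by (simp add: coalgebraD(4)[OF coalg a])
  also have "\<dots> = tensor_map K A A A (tensor K A C) (\<lambda>a. id (id a))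
          (\<lambda>a. tensor_map K A A A C id \<pi> (\<Delta> a)) (\<Delta> a)"
    by (rule tensor_map_compose[OF iA \<Delta> iA A\<pi> \<Delta>a])
  finally show ?thesis by (simp add: coact_R_def[abs_def] id_def)
qed

lemma coact_L_coassoc:
  assumes coalg: "coalgebra K A \<Delta> \<epsilon>" and \<pi>: "linear_map K A C \<pi>" and a: "a \<in> carrier A"
  shows "expand_right K A A A \<Delta> C (coact_L K A \<Delta> C \<pi> a)
    = tensor_map K A A (tensor K C A) A (coact_L K A \<Delta> C \<pi>) id (\<Delta> a)"
proof -
  note \<Delta> = coalgebraD(1)[OF coalg] and A = coalgebraD(3)[OF coalg]
  note iA = linear_map_ident(2)[OF A] and \<Delta>a = linear_mapD(3)[OF \<Delta> a]
  note \<pi>A = tensor_map_linear[OF \<pi> iA]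
  have "expand_right K A A A \<Delta> C (coact_L K A \<Delta> C \<pi> a)
      = tensor_map K (tensor K A A) A (tensor K C A) A (tensor_map K A A C A \<pi> id) id
          (expand_right K A A A \<Delta> A (\<Delta> a))"
    unfolding coact_L_def by (rule expand_right_natural[OF \<Delta> A A \<pi> \<Delta>a, symmetric])
  also have "\<dots> = tensor_map K (tensor K A A) A (tensor K C A) A (tensor_map K A A C A \<pi> id) id
          (tensor_map K A A (tensor K A A) A \<Delta> id (\<Delta> a))"
    by (simp add: coalgebraD(5)[OF coalg a])
  also have "\<dots> = tensor_map K A A (tensor K C A) A
          (\<lambda>a. tensor_map K A A C A \<pi> id (\<Delta> a)) (\<lambda>a. id (id a)) (\<Delta> a)"
    by (rule tensor_map_compose[OF \<Delta> iA \<pi>A iA \<Delta>a])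
  finally show ?thesis by (simp add: coact_L_def[abs_def] id_def)
qed

text \<open>
  The invariance hypothesis of the equalizer criterion holds because both defining maps intertwine the
  cofree coactions of \<open>A \<otimes> V\<close> and \<open>A \<otimes> (C \<otimes> V)\<close>.
\<close>

lemma induced_left_corep:
  assumes coalg: "coalgebra K A \<Delta> \<epsilon>" and \<pi>: "linear_map K A C \<pi>"
    and \<rho>: "linear_map K V (tensor K C V) \<rho>"
  shows "defines_left_corep K A \<Delta> \<epsilon> V (ind_left K A \<Delta> C \<pi> V \<rho>)"
proof -
  note \<Delta> = coalgebraD(1)[OF coalg] and A = coalgebraD(3)[OF coalg]
    and C = linear_mapD(2)[OF \<pi>] and V = linear_mapD(1)[OF \<rho>]
  let ?R = "coact_R K A \<Delta> C \<pi>"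
  note R = coact_R_linear[OF \<Delta> \<pi>] and iA = linear_map_ident(2)[OF A]
  let ?f = "expand_left K A A C ?R V" and ?g = "tensor_map K A V A (tensor K C V) id \<rho>"
  let ?X = "tensor K A (tensor K C V)"
  have "tensor_map K A (tensor K A V) A ?X id ?f (expand_left K A A A \<Delta> V F)
      = tensor_map K A (tensor K A V) A ?X id ?g (expand_left K A A A \<Delta> V F)"
    if F: "F \<in> carrier (tensor K A V)" and eq: "?f F = ?g F" for F
  proof -
    have "tensor_map K A (tensor K A V) A ?X id ?f (expand_left K A A A \<Delta> V F)
        = expand_left K A A A \<Delta> (tensor K C V) (?f F)"
      by (rule expand_left_expand_left[OF R \<Delta> \<Delta> R C A A V coact_R_coassoc[OF coalg \<pi>] F, symmetric])
    also have "\<dots> = expand_left K A A A \<Delta> (tensor K C V) (?g F)"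
      by (simp only: eq)
    also have "\<dots> = tensor_map K A (tensor K A V) A ?X id ?g (expand_left K A A A \<Delta> V F)"
      by (rule expand_left_natural[OF \<Delta> A A \<rho> F, symmetric])
    finally show ?thesis .
  qed
  then have "defines_left_corep K A \<Delta> \<epsilon> V (equalizer (tensor K A V) ?f ?g)"
    by (rule equalizer_defines_left_corep[OF coalg V expand_left_linear[OF R A C V]
          tensor_map_linear[OF iA \<rho>]])
  then show ?thesis
    by (simp add: ind_left_def equalizer_def expand_left_def)
qed

text \<open>
  The defining condition is an equation in \<open>V \<otimes> (C \<otimes> A)\<close>; transported by the inverse associator to
  \<open>(V \<otimes> C) \<otimes> A\<close>, it becomes the equalizer of two maps that intertwine the cofree right coactions.
\<close>

lemma induced_right_corep:
  assumes coalg: "coalgebra K A \<Delta> \<epsilon>" and \<pi>: "linear_map K A C \<pi>"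
    and \<rho>: "linear_map K V (tensor K V C) \<rho>"
  shows "defines_right_corep K A \<Delta> \<epsilon> V (ind_right K A \<Delta> C \<pi> V \<rho>)"
proof -
  note \<Delta> = coalgebraD(1)[OF coalg] and A = coalgebraD(3)[OF coalg]
    and C = linear_mapD(2)[OF \<pi>] and V = linear_mapD(1)[OF \<rho>]
  let ?L = "coact_L K A \<Delta> C \<pi>"
  note L = coact_L_linear[OF \<Delta> \<pi>] and iA = linear_map_ident(2)[OF A]
  let ?f = "expand_right K A C A ?L V" and ?g = "tensor_map K V A (tensor K V C) A \<rho> id"
  let ?X = "tensor K (tensor K V C) A"
  have "tensor_map K (tensor K V A) A ?X A ?f id (expand_right K A A A \<Delta> V F)
      = tensor_map K (tensor K V A) A ?X A ?g id (expand_right K A A A \<Delta> V F)"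
    if F: "F \<in> carrier (tensor K V A)" and eq: "?f F = ?g F" for F
  proof -
    have "tensor_map K (tensor K V A) A ?X A ?f id (expand_right K A A A \<Delta> V F)
        = expand_right K A A A \<Delta> (tensor K V C) (?f F)"
      by (rule expand_right_expand_right[OF L \<Delta> \<Delta> L C A A V coact_L_coassoc[OF coalg \<pi>] F, symmetric])
    also have "\<dots> = expand_right K A A A \<Delta> (tensor K V C) (?g F)"
      by (simp only: eq)
    also have "\<dots> = tensor_map K (tensor K V A) A ?X A ?g id (expand_right K A A A \<Delta> V F)"
      by (rule expand_right_natural[OF \<Delta> A A \<rho> F, symmetric])
    finally show ?thesis .
  qed
  then have *: "defines_right_corep K A \<Delta> \<epsilon> V (equalizer (tensor K V A) ?f ?g)"
    by (rule equalizer_defines_right_corep[OF coalg V expand_right_linear[OF L C A V]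
          tensor_map_linear[OF \<rho> iA]])
  have "?f F = ?g F \<longleftrightarrow>
      tensor_map K V A V (tensor K C A) id ?L F = tensor_assoc K V C A (?g F)"
    if F: "F \<in> carrier (tensor K V A)" for F
    using tensor_assoc_expand_right[OF L C A V F]
      tensor_assoc_inverse(2)[OF V C A linear_mapD(3)[OF tensor_map_linear[OF \<rho> iA] F]]
    by (metis expand_right_def)
  then have "equalizer (tensor K V A) ?f ?g = ind_right K A \<Delta> C \<pi> V \<rho>"
    by (simp add: equalizer_def ind_right_def cong: conj_cong)
  with * show ?thesis by simp
qed

theorem proposition3p4:
  fixes K :: "('k, 'm) ring_scheme"
    and A :: "('k, 'a, 'p) module_scheme"
    and C :: "('k, 'c, 'q) module_scheme"
    and V :: "('k, 'v, 'r) module_scheme"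
  assumes "field K"
    and "\<And>n::nat. n > 0 \<Longrightarrow> [n] \<cdot>\<^bsub>K\<^esub> \<one>\<^bsub>K\<^esub> \<noteq> \<zero>\<^bsub>K\<^esub>"
    and "hopf_algebra K A \<Delta>\<^sub>G \<epsilon>\<^sub>G S"
    and "left_coisotropic K A \<Delta>\<^sub>G \<epsilon>\<^sub>G C \<Delta>\<^sub>K \<epsilon>\<^sub>K lact \<pi> \<or>
         right_coisotropic K A \<Delta>\<^sub>G \<epsilon>\<^sub>G C \<Delta>\<^sub>K \<epsilon>\<^sub>K ract \<pi>"
    and "vectorspace K V"
    and "left_corep K C \<Delta>\<^sub>K \<epsilon>\<^sub>K V \<rho>\<^sub>L"
    and "right_corep K C \<Delta>\<^sub>K \<epsilon>\<^sub>K V \<rho>\<^sub>R"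
  shows "defines_left_corep K A \<Delta>\<^sub>G \<epsilon>\<^sub>G V (ind_left K A \<Delta>\<^sub>G C \<pi> V \<rho>\<^sub>L) \<and>
         defines_right_corep K A \<Delta>\<^sub>G \<epsilon>\<^sub>G V (ind_right K A \<Delta>\<^sub>G C \<pi> V \<rho>\<^sub>R)"
proof -
  have coalg: "coalgebra K A \<Delta>\<^sub>G \<epsilon>\<^sub>G"
    using assms(3) by (simp add: hopf_algebra_def)
  have \<pi>: "linear_map K A C \<pi>"
    using assms(4) by (auto simp: left_coisotropic_def right_coisotropic_def coalgebra_hom_def)
  have \<rho>: "linear_map K V (tensor K C V) \<rho>\<^sub>L" "linear_map K V (tensor K V C) \<rho>\<^sub>R"
    using assms(6,7) by (simp_all add: left_corep_def right_corep_def)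
  show ?thesis
    using induced_left_corep[OF coalg \<pi> \<rho>(1)] induced_right_corep[OF coalg \<pi> \<rho>(2)] by blast
qed

end
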